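(* Fix integers $g\ge 1$ and $n\ge 1$, and let $t=2g+n-1$. For a tuple $\beta=(\beta_1,\ldots,\beta_n)$ of positive integers with $d=\beta_1+\cdots+\beta_n$, the number $\mathsf{H}^g_{d,d}(\beta)/(t!\,d)$ is given by a symmetric polynomial in $\beta_1,\ldots,\beta_n$ of highest degree $4g+n-3$ and lowest degree $2g+n-3$. For nonnegative integers $b_1,\ldots,b_n$ with $b=b_1+\cdots+b_n\ge 2g-3$ and $b+2k=4g+n-3$ for an integer $k\ge 0$, the coefficient of $\beta_1^{b_1}\cdots\beta_n^{b_n}$ satisfies $$(-1)^{\frac{4g-3+n-b}{2}}\langle\langle\tau_{b_1}\cdots\tau_{b_n}\Lambda_{2k}\rangle\rangle'_g=\mathbf{C}_{b,g,n}\,\widehat{\mathbf{C}}_g(b_1,\ldots,b_n),$$ where $$\widehat{\mathbf{C}}_g(b_1,\ldots,b_n)=[x^{2g+n-3}]\,(2g+n-3)!\,(b+3-2g)!\prod_{i=1}^n\frac{(x+1)^{b_i+1}-(x-1)^{b_i+1}}{(b_i+1)!}.$$ In particular, if $b+n$ is even then $\langle\langle\tau_{b_1}\cdots\tau_{b_n}\Lambda_{2k}\rangle\rangle'_g=0$. Moreover, if $b_1+\cdots+b_n=2g+n-3$, then $$\langle\langle\tau_{b_1}\cdots\tau_{b_n}\Lambda_{2g}\rangle\rangle'_g=(-1)^g\binom{2g+n-3}{b_1,\ldots,b_n}\frac{1-2^{2g-1}}{2^{2g-1}(2g)!}B_{2g}.$$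
   Context: For a partition $\beta=[1^{a_1},\ldots,d^{a_d}]\vdash d$ with $n$ parts (a tuple is identified with its sorted partition), $\mathrm{Aut}(\beta)=\prod_i a_i!$, and $\mathsf{H}^g_{d,d}(\beta)=\frac{\mathrm{Aut}(\beta)}{d!}N$ where $N$ is the number of tuples $(\sigma_0,\tau_1,\ldots,\tau_t,\sigma_{t+1})$ in $\mathfrak{S}_d$, $t=2g-1+n$, with $\sigma_0$ a $d$-cycle, each $\tau_i$ a transposition, $\sigma_{t+1}$ of cycle type $\beta$, and $\sigma_0\tau_1\cdots\tau_t\sigma_{t+1}$ equal to the identity (i.e., having $d$ cycles). For $b_i\ge0$, $k\ge 0$ with $b_1+\cdots+b_n+2k=4g-3+n$, define $\langle\langle\tau_{b_1}\cdots\tau_{b_n}\Lambda_{2k}\rangle\rangle'_g=(-1)^k[\beta_1^{b_1}\cdots\beta_n^{b_n}]\frac{\mathsf{H}^g_{d,d}(\beta)}{t!\,d}$ (coefficient in the polynomial above), and set it to $0$ otherwise. $\mathbf{C}_{b,g,n}=\frac{1}{(b+3-2g)!}\sum_{k=0}^{2g+n}\frac{1}{(k+2g-b-3)!}\frac{B_{2g+n-k}}{(2g+n-k)!2^k}$ with $1/r!=0$ for $r<0$, where $B_r$ are the Bernoulli numbers, $\frac{x}{e^x-1}=\sum_r B_r\frac{x^r}{r!}$. $[x^j]$ denotes coefficient extraction. *)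

theory Defs
  imports "HOL-Combinatorics.Combinatorics" "HOL-Computational_Algebra.Computational_Algebra"
begin

(* Bernoulli numbers via x/(e^x - 1) = sum_r B_r x^r / r!  (so B_1 = -1/2) *)
definition bernoulli_num :: "nat \<Rightarrow> real" where
  "bernoulli_num r = fact r * fps_nth (fps_X / (fps_exp 1 - 1)) r"

definition inv_fact :: "int \<Rightarrow> real" where
  "inv_fact r = (if r < 0 then 0 else 1 / fact (nat r))"

definition orbit_of :: "(nat \<Rightarrow> nat) \<Rightarrow> nat \<Rightarrow> nat set" where
  "orbit_of \<sigma> x = {(\<sigma> ^^ k) x | k. True}"

definition cycle_type :: "nat \<Rightarrow> (nat \<Rightarrow> nat) \<Rightarrow> nat multiset" where
  "cycle_type d \<sigma> = image_mset card (mset_set (orbit_of \<sigma> ` {0..<d}))"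

definition is_transposition_on :: "nat \<Rightarrow> (nat \<Rightarrow> nat) \<Rightarrow> bool" where
  "is_transposition_on d \<tau> \<longleftrightarrow> (\<exists>a b. a < d \<and> b < d \<and> a \<noteq> b \<and> \<tau> = transpose a b)"

definition hurwitz_count :: "nat \<Rightarrow> nat list \<Rightarrow> nat" where
  "hurwitz_count g \<beta> =
     (let d = sum_list \<beta>; n = length \<beta>; t = 2 * g - 1 + n in
      card {(\<sigma>0, \<tau>s, \<sigma>1).
              \<sigma>0 permutes {0..<d} \<and> cycle_type d \<sigma>0 = {#d#} \<and>
              length \<tau>s = t \<and> (\<forall>\<tau>\<in>set \<tau>s. is_transposition_on d \<tau>) \<and>
              \<sigma>1 permutes {0..<d} \<and> cycle_type d \<sigma>1 = mset \<beta> \<and>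
              \<sigma>0 \<circ> foldr (\<circ>) \<tau>s id \<circ> \<sigma>1 = id})"

definition aut :: "nat list \<Rightarrow> nat" where
  "aut \<beta> = (\<Prod>i\<in>set \<beta>. fact (count (mset \<beta>) i))"

definition H_dd :: "nat \<Rightarrow> nat list \<Rightarrow> real" where
  "H_dd g \<beta> = real (aut \<beta>) / fact (sum_list \<beta>) * real (hurwitz_count g \<beta>)"

(* Multivariate polynomials in n variables represented by coefficient functions on
   exponent vectors (lists of length n) with finite support *)
definition is_poly_coeffs :: "nat \<Rightarrow> (nat list \<Rightarrow> real) \<Rightarrow> bool" where
  "is_poly_coeffs n c \<longleftrightarrow> finite {e. c e \<noteq> 0} \<and> (\<forall>e. c e \<noteq> 0 \<longrightarrow> length e = n)"

definition poly_eval :: "(nat list \<Rightarrow> real) \<Rightarrow> nat list \<Rightarrow> real" where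
  "poly_eval c \<beta> = (\<Sum>e\<in>{e. c e \<noteq> 0}. c e * (\<Prod>i<length \<beta>. real (\<beta> ! i) ^ (e ! i)))"

definition symmetric_coeffs :: "nat \<Rightarrow> (nat list \<Rightarrow> real) \<Rightarrow> bool" where
  "symmetric_coeffs n c \<longleftrightarrow> (\<forall>p e. p permutes {..<n} \<and> length e = n \<longrightarrow> c (permute_list p e) = c e)"

(* <<tau_{b_1} ... tau_{b_n} Lambda_{2k}>>'_g, where c is the coefficient function of the
   polynomial H^g_{d,d}(beta)/(t! d) *)
definition dbracket :: "(nat list \<Rightarrow> real) \<Rightarrow> nat \<Rightarrow> nat list \<Rightarrow> nat \<Rightarrow> real" where
  "dbracket c g bs k =
     (if sum_list bs + 2 * k = 4 * g - 3 + length bs then (-1) ^ k * c bs else 0)"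

definition C_const :: "nat \<Rightarrow> nat \<Rightarrow> nat \<Rightarrow> real" where
  "C_const b g n = inv_fact (int b + 3 - 2 * int g) *
     (\<Sum>k=0..2*g+n. inv_fact (int k + 2 * int g - int b - 3) *
        bernoulli_num (2*g+n-k) / (fact (2*g+n-k) * 2 ^ k))"

definition Chat :: "nat \<Rightarrow> nat list \<Rightarrow> real" where
  "Chat g bs = (let n = length bs; b = sum_list bs in
     fact (2*g+n-3) * fact (nat (int b + 3 - 2 * int g)) *
     coeff (\<Prod>i<n. smult (1 / fact (bs ! i + 1))
                 ([:1, 1:] ^ (bs ! i + 1) - [:-1, 1:] ^ (bs ! i + 1))) (2*g+n-3))"

definition multinomial_coeff :: "nat list \<Rightarrow> real" where
  "multinomial_coeff bs = fact (sum_list bs) / (\<Prod>i<length bs. fact (bs ! i))"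

end

theory Submission
  imports Defs
begin

text \<open>
  Attach to a permutation \<open>\<sigma>\<close> of a \<open>d\<close>-element set the series
  \<open>G\<^sub>\<sigma>(x) = (\<Prod>\<^bsub>C\<^esub> 2 sinh (|C| x / 2)) / (2 sinh (x / 2))\<close>, the product being over the cycles of
  \<open>\<sigma>\<close>. Multiplication by a transposition cuts a cycle or joins two, and the addition theorems for
  \<open>sinh\<close> and \<open>coth\<close> turn this into \<open>\<Sum>\<^sub>\<tau> G\<^bsub>\<tau>\<sigma>\<^esub> = d \<cdot> G\<^sub>\<sigma>'\<close>. As \<open>G\<^sub>\<sigma>(0)\<close> is \<open>d\<close> for a \<open>d\<close>-cycle
  and \<open>0\<close> otherwise, iterating \<open>t\<close> times and taking constant coefficients counts the factorizations:
  there are \<open>t! d\<^bsup>t-1\<^esup> [x\<^sup>t] G\<^sub>\<sigma>\<close> of them. Together with the size of the conjugacy class this is the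
  formula of Goulden, Jackson and Vakil,
  \<open>H / (t! d) = d\<^bsup>t-2\<^esup> [x\<^bsup>2g\<^esup>] (\<Prod>\<^sub>i S(\<beta>\<^sub>i x)) / S(x)\<close> with \<open>S(x) = sinh (x/2) / (x/2)\<close>.
  The coefficients are then read off using \<open>1 / S(x) = e\<^bsup>x/2\<^esup> x / (e\<^sup>x - 1)\<close>; the lowest degree is
  attained because \<open>B\<^bsub>2g\<^esub> \<noteq> 0\<close>.
\<close>

section \<open>Cycles of permutations\<close>

text \<open>Cycles are kept as lists so that they can be cut at a given entry. A cycle of length m
  has m traces, one for each starting point; a fixed point is traced by a singleton.\<close>

definition traces_cycle :: "(nat \<Rightarrow> nat) \<Rightarrow> nat list \<Rightarrow> bool" where
  "traces_cycle f xs \<longleftrightarrow> xs \<noteq> [] \<and> distinct xs \<and> map f xs = rotate1 xs"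

text \<open>The ground set is arbitrary, so that whole cycles can be removed from it.\<close>

definition cycle_lengths :: "nat set \<Rightarrow> (nat \<Rightarrow> nat) \<Rightarrow> nat multiset" where
  "cycle_lengths A f = image_mset card (mset_set (orbit_of f ` A))"

lemma cycle_type_eq_cycle_lengths: "cycle_type d f = cycle_lengths {0..<d} f"
  by (simp add: cycle_type_def cycle_lengths_def)

lemma self_in_orbit_of: "x \<in> orbit_of f x"
  unfolding orbit_of_def by (auto intro: exI[of _ 0])

lemma orbit_of_subset:
  assumes "x \<in> S" "\<And>y. y \<in> S \<Longrightarrow> f y \<in> S"
  shows "orbit_of f x \<subseteq> S"
proof -
  have "(f ^^ k) x \<in> S" for k by (induction k) (use assms in auto)
  then show ?thesis by (auto simp: orbit_of_def)
qed

lemma orbit_of_cong: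
  assumes "\<And>y. y \<in> orbit_of f x \<Longrightarrow> f y = h y"
  shows "orbit_of f x = orbit_of h x"
proof -
  have "(f ^^ k) x = (h ^^ k) x" for k
  proof (induction k)
    case (Suc k)
    have "f ((f ^^ k) x) = h ((f ^^ k) x)" by (rule assms) (auto simp: orbit_of_def)
    then show ?case using Suc by simp
  qed simp
  then show ?thesis by (simp add: orbit_of_def)
qed

lemma traces_cycle_funpow:
  assumes "traces_cycle f xs" shows "map (f ^^ k) xs = rotate k xs"
proof (induction k)
  case (Suc k)
  have "map (f ^^ Suc k) xs = map f (rotate k xs)"
    by (simp flip: Suc.IH)
  also have "\<dots> = rotate (Suc k) xs"
    using assms by (simp add: traces_cycle_def rotate1_rotate_swap flip: rotate_map)
  finally show ?case .
qed simp

lemma traces_cycle_nth: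
  assumes "traces_cycle f xs" "i < length xs" shows "xs ! i = (f ^^ i) (hd xs)"
proof -
  have "xs \<noteq> []" using assms(2) by auto
  then have "(f ^^ i) (hd xs) = hd (map (f ^^ i) xs)" by (simp add: hd_map)
  also have "\<dots> = xs ! i" using assms \<open>xs \<noteq> []\<close> 
    by (simp add: traces_cycle_funpow hd_rotate_conv_nth)
  finally show ?thesis by simp
qed

lemma traces_cycle_orbit_of:
  assumes "traces_cycle f xs" "x \<in> set xs" shows "orbit_of f x = set xs"
proof
  have "f ` set xs = set xs" using assms(1) unfolding traces_cycle_def
    by (metis set_map set_rotate1)
  then show "orbit_of f x \<subseteq> set xs" using assms(2) by (intro orbit_of_subset) auto
  show "set xs \<subseteq> orbit_of f x"
  proof
    fix y assume "y \<in> set xs"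
    then obtain j where j: "j < length xs" "y = xs ! j" by (auto simp: in_set_conv_nth)
    obtain i where i: "i < length xs" "x = xs ! i" using assms(2) by (auto simp: in_set_conv_nth)
    \<comment> \<open>Adding \<open>length xs\<close> keeps the subtraction exact when
      \<open>j < i\<close>.\<close>
    define k where "k = j + length xs - i"
    have "(f ^^ k) x = rotate k xs ! i"
      using i traces_cycle_funpow[OF assms(1), of k] by (metis nth_map)
    also have "\<dots> = xs ! ((k + i) mod length xs)" using i by (simp add: nth_rotate)
    also have "(k + i) mod length xs = j" using i j by (simp add: k_def)
    finally show "y \<in> orbit_of f x" using j unfolding orbit_of_def by (auto intro: sym)
  qed
qed

lemma traces_cycle_card_orbit_of:
  "traces_cycle f xs \<Longrightarrow> x \<in> set xs \<Longrightarrow> card (orbit_of f x) = length xs"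
  by (simp add: traces_cycle_orbit_of distinct_card traces_cycle_def)

text \<open>The length is the size of the orbit, and the entries are iterates of \<open>f\<close> at
  the head.\<close>

lemma traces_cycle_unique:
  assumes "traces_cycle f xs" "traces_cycle f ys" "hd xs = hd ys" shows "xs = ys"
proof (rule nth_equalityI)
  have ne: "xs \<noteq> []" "ys \<noteq> []" using assms by (auto simp: traces_cycle_def)
  have "length xs = card (orbit_of f (hd xs))"
    using traces_cycle_card_orbit_of[OF assms(1)] ne by simp
  also have "\<dots> = length ys"
    using traces_cycle_card_orbit_of[OF assms(2)] ne assms(3) by simp
  finally show len: "length xs = length ys" .
  show "xs ! i = ys ! i" if "i < length xs" for i
    using that len assms by (simp add: traces_cycle_nth)
qed

text \<open>The list consists of the iterates of \<open>x\<close> below its period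
  \<open>least_power f x\<close>; the next iterate is \<open>x\<close> again, as
  \<open>rotate1\<close> demands.\<close>

lemma traces_cycle_exists:
  assumes "f permutes A" "finite A"
  obtains xs where "traces_cycle f (x # xs)"
proof -
  have perm: "permutation f" using assms by (auto simp: permutation_permutes)
  define L where "L = least_power f x"
  have L: "(f ^^ L) x = x" "L > 0" using least_power_of_permutation[OF perm] by (auto simp: L_def)
  define ys where "ys = map (\<lambda>i. (f ^^ i) x) [0..<L]"
  obtain l where l: "L = Suc l" using L(2) by (cases L) auto
  have ys: "ys = x # map (\<lambda>i. (f ^^ i) x) [1..<L]"
    by (simp add: ys_def upt_conv_Cons L)
  have "map f ys = map (\<lambda>i. (f ^^ i) x) (map Suc [0..<L])" by (simp add: ys_def)
  also have "\<dots> = map (\<lambda>i. (f ^^ i) x) ([1..<L] @ [L])" unfolding map_Suc_upt using l by simp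
  also have "\<dots> = rotate1 ys" using L unfolding ys by simp
  finally have "traces_cycle f ys"
    using cycle_of_permutation[OF perm, of x] unfolding traces_cycle_def
    by (simp add: ys L_def[symmetric] ys_def[symmetric])
  then show ?thesis using that ys by metis
qed

lemma orbit_of_permutes_subset:
  assumes "f permutes A" "x \<in> A" shows "orbit_of f x \<subseteq> A"
  using assms by (intro orbit_of_subset) (auto simp: permutes_in_image)

lemma orbit_of_eq:
  assumes "f permutes A" "finite A" "y \<in> orbit_of f x" shows "orbit_of f y = orbit_of f x"
proof -
  obtain xs where xs: "traces_cycle f (x # xs)" using traces_cycle_exists assms(1,2) by blast
  from traces_cycle_orbit_of[OF xs] assms(3) show ?thesis by (metis list.set_intros(1))
qed

lemma orbit_of_disjoint:
  assumes "f permutes A" "finite A" "y \<notin> orbit_of f x"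
  shows "orbit_of f y \<inter> orbit_of f x = {}"
  using orbit_of_eq[OF assms(1,2)] assms(3) self_in_orbit_of by blast

lemma card_orbit_of_pos:
  assumes "f permutes A" "finite A" shows "card (orbit_of f x) > 0"
proof -
  obtain xs where xs: "traces_cycle f (x # xs)" using traces_cycle_exists assms by blast
  then show ?thesis using traces_cycle_card_orbit_of[OF xs, of x] by simp
qed

text \<open>A point \<open>y\<close> is one step after its preimage, so a backward step stays in the
  orbit; the other inclusion is the same statement for the inverse.\<close>

lemma orbit_of_inv:
  assumes "f permutes A" "finite A" shows "orbit_of (inv f) x = orbit_of f x"
proof -
  have 1: "orbit_of (inv h) x \<subseteq> orbit_of h x" if h: "h permutes A" for h
  proof (rule orbit_of_subset[OF self_in_orbit_of])
    fix y assume y: "y \<in> orbit_of h x"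
    have o: "orbit_of h (inv h y) = orbit_of h y"
    proof -
      have "y \<in> orbit_of h (inv h y)" unfolding orbit_of_def
        using permutes_inverses(1)[OF h] by (auto intro!: exI[of _ 1])
      then show ?thesis using orbit_of_eq[OF h assms(2)] by blast
    qed
    show "inv h y \<in> orbit_of h x"
      using o orbit_of_eq[OF h assms(2) y] self_in_orbit_of by metis
  qed
  show ?thesis using 1[OF assms(1)] 1[OF permutes_inv[OF assms(1)]] 
    by (simp add: permutes_inv_inv[OF assms(1)])
qed

text \<open>In a factorization of the identity the leading factor is the inverse of the rest; this
  moves the condition on its cycle type to the rest.\<close>

lemma cycle_lengths_inv:
  "f permutes A \<Longrightarrow> finite A \<Longrightarrow> cycle_lengths A (inv f) = cycle_lengths A f"
  by (simp add: cycle_lengths_def orbit_of_inv)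

text \<open>Points are grouped by orbit, and an orbit \<open>C\<close> collects
  \<open>card C\<close> equal terms.\<close>

lemma sum_orbits:
  fixes w :: "nat \<Rightarrow> 'a :: comm_semiring_1"
  assumes "f permutes A" "finite A"
  shows "(\<Sum>x\<in>A. w (card (orbit_of f x))) = (\<Sum>C\<in>orbit_of f ` A. of_nat (card C) * w (card C))"
proof -
  have "(\<Sum>x\<in>A. w (card (orbit_of f x))) = (\<Sum>C\<in>orbit_of f ` A. \<Sum>x\<in>{x\<in>A. orbit_of f x = C}. w (card (orbit_of f x)))"
    using assms by (subst sum.group[symmetric, where g = "orbit_of f" and T = "orbit_of f ` A"]) auto
  also have "\<dots> = (\<Sum>C\<in>orbit_of f ` A. of_nat (card C) * w (card C))"
  proof (rule sum.cong[OF refl])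
    fix C assume "C \<in> orbit_of f ` A"
    then obtain y where y: "y \<in> A" "C = orbit_of f y" by auto
    have "{x\<in>A. orbit_of f x = C} = C"
      using orbit_of_eq[OF assms] y self_in_orbit_of orbit_of_permutes_subset[OF assms(1) y(1)] by blast
    then show "(\<Sum>x\<in>{x\<in>A. orbit_of f x = C}. w (card (orbit_of f x))) = of_nat (card C) * w (card C)"
      by (metis (mono_tags, lifting) mem_Collect_eq sum.cong sum_constant)
  qed
  finally show ?thesis .
qed

lemma sum_mset_cycle_lengths:
  assumes "f permutes A" "finite A" shows "sum_mset (cycle_lengths A f) = card A"
  using sum_orbits[OF assms, of "\<lambda>_. 1::nat"]
  by (simp add: cycle_lengths_def sum_unfold_sum_mset)

lemma count_cycle_lengths:
  assumes "f permutes A" "finite A"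
  shows "card {x\<in>A. card (orbit_of f x) = m} = m * count (cycle_lengths A f) m"
proof -
  have "card {x\<in>A. card (orbit_of f x) = m} = (\<Sum>x\<in>A. if card (orbit_of f x) = m then 1 else 0)"
    using assms(2) by (simp add: sum.If_cases Int_def)
  also have "\<dots> = (\<Sum>C\<in>orbit_of f ` A. card C * (if card C = m then 1 else 0))"
    by (subst sum_orbits[OF assms, of "\<lambda>k. if k = m then 1 else 0 :: nat"]) simp
  also have "\<dots> = (\<Sum>C\<in>orbit_of f ` A. if card C = m then m else 0)"
    by (intro sum.cong) auto
  also have "\<dots> = m * card {C \<in> orbit_of f ` A. card C = m}"
    using assms(2) by (simp add: sum.If_cases Int_def)
  also have "card {C \<in> orbit_of f ` A. card C = m} = count (cycle_lengths A f) m"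
    using assms(2) unfolding cycle_lengths_def count_image_mset'
    by (simp add: eq_commute)
  finally show ?thesis .
qed

section \<open>Multiplication by a transposition\<close>

text \<open>\<open>f\<close> sends the last entry of \<open>a # us\<close> to \<open>b\<close> and
  that of \<open>b # vs\<close> to \<open>a\<close>. Composing with the transposition exchanges
  these two targets, so each half closes up on itself.\<close>

lemma traces_cycle_split:
  assumes "traces_cycle f (a # us @ b # vs)"
  shows "traces_cycle (transpose a b \<circ> f) (a # us)" "traces_cycle (transpose a b \<circ> f) (b # vs)"
proof -
  have d: "distinct (a # us @ b # vs)" using assms by (simp add: traces_cycle_def)
  have "map f (a # us) @ map f (b # vs) = (us @ [b]) @ (vs @ [a])"
    using assms by (simp add: traces_cycle_def)
  then have f: "map f (a # us) = us @ [b]" "map f (b # vs) = vs @ [a]"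
    by (subst (asm) append_eq_append_conv; simp)+
  have id: "map (transpose a b) us = us" "map (transpose a b) vs = vs"
    using d by (auto intro!: map_idI transpose_apply_other)
  have "map (transpose a b \<circ> f) (a # us) = us @ [a]"
    unfolding map_map[symmetric] f by (simp add: id)
  moreover have "map (transpose a b \<circ> f) (b # vs) = vs @ [b]"
    unfolding map_map[symmetric] f by (simp add: id)
  ultimately show "traces_cycle (transpose a b \<circ> f) (a # us)" "traces_cycle (transpose a b \<circ> f) (b # vs)"
    using d by (auto simp: traces_cycle_def)
qed

text \<open>The converse: exchanging the targets links the end of each cycle to the start of the
  other.\<close>

lemma traces_cycle_join:
  assumes "traces_cycle f (a # us)" "traces_cycle f (b # vs)" "set (a # us) \<inter> set (b # vs) = {}"
  shows "traces_cycle (transpose a b \<circ> f) (a # us @ b # vs)"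
proof -
  have d: "distinct (a # us @ b # vs)" using assms by (auto simp: traces_cycle_def)
  have f: "map f (a # us @ b # vs) = us @ [a] @ vs @ [b]"
    using assms by (simp add: traces_cycle_def)
  have id: "map (transpose a b) us = us" "map (transpose a b) vs = vs"
    using d by (auto intro!: map_idI transpose_apply_other)
  have "map (transpose a b \<circ> f) (a # us @ b # vs) = us @ [b] @ vs @ [a]"
    unfolding map_map[symmetric] f by (simp add: id)
  then show ?thesis using d by (auto simp: traces_cycle_def)
qed

text \<open>On this orbit \<open>f\<close> never takes the value \<open>a\<close> or
  \<open>b\<close>, so the transposition has nothing to move.\<close>

lemma orbit_of_transpose_other:
  assumes "f permutes A" "finite A" "x \<notin> orbit_of f a" "x \<notin> orbit_of f b"
  shows "orbit_of (transpose a b \<circ> f) x = orbit_of f x"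
proof (rule orbit_of_cong[symmetric])
  fix y assume "y \<in> orbit_of f x"
  then have "orbit_of f (f y) = orbit_of f x"
  proof -
    obtain k where "y = (f ^^ k) x" using \<open>y \<in> _\<close> by (auto simp: orbit_of_def)
    then have "f y = (f ^^ Suc k) x" by simp
    then have "f y \<in> orbit_of f x" unfolding orbit_of_def by blast
    then show ?thesis by (rule orbit_of_eq[OF assms(1,2)])
  qed
  then have "f y \<noteq> a" "f y \<noteq> b" using assms(3,4) self_in_orbit_of by metis+
  then show "f y = (transpose a b \<circ> f) y" by simp
qed

section \<open>Cycle lengths after a cut or a join\<close>

lemma cycle_lengths_decompose:
  assumes "f permutes A" "finite A" "B \<subseteq> A" "\<And>x. x \<in> B \<Longrightarrow> orbit_of f x \<subseteq> B"
  shows "cycle_lengths A f = cycle_lengths B f + cycle_lengths (A - B) f"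
proof -
  \<comment> \<open>A point of \<open>B\<close> on the orbit would pull the whole orbit, and with it
    \<open>x\<close>, into \<open>B\<close>.\<close>
  have "orbit_of f x \<inter> B = {}" if "x \<in> A - B" for x
    using that assms(4) orbit_of_eq[OF assms(1,2)] self_in_orbit_of by blast
  then have disj: "orbit_of f ` B \<inter> orbit_of f ` (A - B) = {}"
    using assms(4) self_in_orbit_of by blast
  have "orbit_of f ` A = orbit_of f ` B \<union> orbit_of f ` (A - B)" using assms(3) by blast
  moreover have "finite B" using assms by (meson finite_subset)
  ultimately show ?thesis using assms(2) disj
    by (simp add: cycle_lengths_def mset_set_Union)
qed

lemma cycle_lengths_trace:
  assumes "traces_cycle f xs" shows "cycle_lengths (set xs) f = {#length xs#}"
proof -
  have "orbit_of f ` set xs = {set xs}"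
    using traces_cycle_orbit_of[OF assms] assms by (simp add: traces_cycle_def image_constant_conv)
  then show ?thesis using assms by (simp add: cycle_lengths_def traces_cycle_def distinct_card)
qed

lemma traces_cycle_subset:
  assumes "f permutes A" "traces_cycle f xs" "hd xs \<in> A" shows "set xs \<subseteq> A"
  using orbit_of_permutes_subset[OF assms(1,3)] traces_cycle_orbit_of[OF assms(2), of "hd xs"] assms(2)
  by (simp add: traces_cycle_def)

lemma cycle_lengths_two:
  assumes "f permutes A" "finite A" "traces_cycle f xs" "traces_cycle f ys"
    "set xs \<inter> set ys = {}" "set xs \<subseteq> A" "set ys \<subseteq> A"
  shows "cycle_lengths A f = {#length xs, length ys#} + cycle_lengths (A - (set xs \<union> set ys)) f"
proof -
  have "cycle_lengths A f = cycle_lengths (set xs) f + cycle_lengths (A - set xs) f"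
    using assms traces_cycle_orbit_of by (intro cycle_lengths_decompose) auto
  also have "cycle_lengths (A - set xs) f = cycle_lengths (set ys) f + cycle_lengths (A - set xs - set ys) f"
  proof -
    have "orbit_of f ` (A - set xs) = orbit_of f ` set ys \<union> orbit_of f ` (A - set xs - set ys)"
      using assms by blast
    moreover have "orbit_of f ` set ys \<inter> orbit_of f ` (A - set xs - set ys) = {}"
      using traces_cycle_orbit_of[OF assms(4)] self_in_orbit_of by blast
    ultimately show ?thesis using assms(2)
      by (simp add: cycle_lengths_def mset_set_Union)
  qed
  finally show ?thesis using assms by (simp add: cycle_lengths_trace Diff_eq Int_assoc Compl_Un)
qed

lemma cycle_lengths_one:
  assumes "f permutes A" "finite A" "traces_cycle f xs" "set xs \<subseteq> A"
  shows "cycle_lengths A f = {#length xs#} + cycle_lengths (A - set xs) f"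
  using assms traces_cycle_orbit_of 
  by (subst cycle_lengths_decompose[of f A "set xs"]) (auto simp: cycle_lengths_trace)

lemma cycle_lengths_transpose_rest:
  assumes "f permutes A" "finite A" "S = orbit_of f a \<union> orbit_of f b"
  shows "cycle_lengths (A - S) (transpose a b \<circ> f) = cycle_lengths (A - S) f"
proof -
  have "orbit_of (transpose a b \<circ> f) ` (A - S) = orbit_of f ` (A - S)"
    using assms by (intro image_cong refl orbit_of_transpose_other) auto
  then show ?thesis by (simp add: cycle_lengths_def)
qed

lemma transpose_comp_permutes:
  "f permutes A \<Longrightarrow> a \<in> A \<Longrightarrow> b \<in> A \<Longrightarrow> (transpose a b \<circ> f) permutes A"
  by (intro permutes_compose permutes_swap_id)

text \<open>The common remainder \<open>M\<close> gathers the untouched cycles, so that the series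
  before and after the cut differ only in the displayed factors.\<close>

lemma cycle_lengths_cut:
  assumes f: "f permutes A" "finite A" "a \<in> A" and tr: "traces_cycle f (a # us @ b # vs)"
  obtains M where "cycle_lengths A f = {#length us + length vs + 2#} + M"
    "cycle_lengths A (transpose a b \<circ> f) = {#length us + 1, length vs + 1#} + M"
proof -
  let ?xs = "a # us @ b # vs" and ?t = "transpose a b \<circ> f"
  have sub: "set ?xs \<subseteq> A" using traces_cycle_subset[OF f(1) tr] f(3) by simp
  have t: "?t permutes A" using f sub by (intro transpose_comp_permutes) auto
  have d: "distinct ?xs" using tr by (simp add: traces_cycle_def)
  have S: "set ?xs = orbit_of f a \<union> orbit_of f b"
    using traces_cycle_orbit_of[OF tr, of a] traces_cycle_orbit_of[OF tr, of b] by simp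
  have S': "set (a # us) \<union> set (b # vs) = set ?xs" by auto
  have "cycle_lengths A f = {#length us + length vs + 2#} + cycle_lengths (A - set ?xs) f"
    using cycle_lengths_one[OF f(1,2) tr sub] by simp
  moreover have "cycle_lengths A ?t = {#length (a # us), length (b # vs)#} + cycle_lengths (A - set ?xs) ?t"
    using cycle_lengths_two[OF t f(2) traces_cycle_split[OF tr]] d sub unfolding S' by auto
  ultimately show ?thesis
    using that cycle_lengths_transpose_rest[OF f(1,2) S] by simp
qed

lemma cycle_lengths_join:
  assumes f: "f permutes A" "finite A" "a \<in> A" "b \<in> A" and nb: "b \<notin> orbit_of f a"
  obtains M where "cycle_lengths A f = {#card (orbit_of f a), card (orbit_of f b)#} + M"
    "cycle_lengths A (transpose a b \<circ> f) = {#card (orbit_of f a) + card (orbit_of f b)#} + M"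
proof -
  let ?t = "transpose a b \<circ> f"
  obtain us vs where tr: "traces_cycle f (a # us)" "traces_cycle f (b # vs)"
    using traces_cycle_exists[OF f(1,2)] by metis
  have o: "orbit_of f a = set (a # us)" "orbit_of f b = set (b # vs)"
    "card (orbit_of f a) = length (a # us)" "card (orbit_of f b) = length (b # vs)"
    using traces_cycle_orbit_of[OF tr(1), of a] traces_cycle_orbit_of[OF tr(2), of b]
      traces_cycle_card_orbit_of[OF tr(1), of a] traces_cycle_card_orbit_of[OF tr(2), of b] by simp_all
  have disj: "set (a # us) \<inter> set (b # vs) = {}" using orbit_of_disjoint[OF f(1,2) nb] o by auto
  have sub: "set (a # us) \<subseteq> A" "set (b # vs) \<subseteq> A" 
    using traces_cycle_subset[OF f(1)] tr f by (metis list.sel(1))+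
  have t: "?t permutes A" using f sub by (intro transpose_comp_permutes) auto
  note j = traces_cycle_join[OF tr disj]
  have S: "set (a # us @ b # vs) = orbit_of f a \<union> orbit_of f b" using o by auto
  have S': "set (a # us) \<union> set (b # vs) = set (a # us @ b # vs)" by auto
  have "cycle_lengths A f = {#length (a # us), length (b # vs)#} + cycle_lengths (A - set (a # us @ b # vs)) f"
    using cycle_lengths_two[OF f(1,2) tr disj sub] unfolding S' .
  moreover have "cycle_lengths A ?t = {#length (a # us @ b # vs)#} + cycle_lengths (A - set (a # us @ b # vs)) ?t"
    using cycle_lengths_one[OF t f(2) j] sub by simp
  ultimately show ?thesis
    using that cycle_lengths_transpose_rest[OF f(1,2) S] unfolding o(3,4) by simp
qed

section \<open>Sizes of conjugacy classes\<close>

text \<open>Building block for counting a conjugacy class: a permutation of the complement is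
  completed by one prescribed cycle.\<close>

lemma extend_by_cycle:
  assumes "finite A" "xs \<noteq> []" "distinct xs" "set xs \<subseteq> A" "\<rho> permutes (A - set xs)"
  defines "c \<equiv> cycle_of_list xs"
  shows "(c \<circ> \<rho>) permutes A" "traces_cycle (c \<circ> \<rho>) xs"
    "cycle_lengths A (c \<circ> \<rho>) = add_mset (length xs) (cycle_lengths (A - set xs) \<rho>)"
proof -
  have c: "c permutes set xs" unfolding c_def by (rule cycle_permutes)
  have rot: "map c xs = rotate1 xs" unfolding c_def using cyclic_rotation[OF assms(3), of 1] by simp
  show p: "(c \<circ> \<rho>) permutes A"
    using c assms by (intro permutes_compose) (auto intro: permutes_subset)
  have "map (c \<circ> \<rho>) xs = map c xs"
    using assms(5) by (intro map_cong refl) (auto simp: permutes_not_in)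
  then show tr: "traces_cycle (c \<circ> \<rho>) xs" using assms(2,3) rot by (simp add: traces_cycle_def del: map_eq_conv)
  have "orbit_of \<rho> x = orbit_of (c \<circ> \<rho>) x" if "x \<in> A - set xs" for x
  proof (rule orbit_of_cong)
    fix y assume "y \<in> orbit_of \<rho> x"
    then have "y \<in> A - set xs" using orbit_of_permutes_subset[OF assms(5) that] by blast
    then have "\<rho> y \<in> A - set xs" using permutes_in_image[OF assms(5)] by blast
    then show "\<rho> y = (c \<circ> \<rho>) y" using c by (simp add: permutes_not_in)
  qed
  then have "orbit_of (c \<circ> \<rho>) ` (A - set xs) = orbit_of \<rho> ` (A - set xs)" by (metis image_cong)
  then have "cycle_lengths (A - set xs) (c \<circ> \<rho>) = cycle_lengths (A - set xs) \<rho>"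
    by (simp add: cycle_lengths_def)
  then show "cycle_lengths A (c \<circ> \<rho>) = add_mset (length xs) (cycle_lengths (A - set xs) \<rho>)"
    using cycle_lengths_one[OF p assms(1) tr assms(4)] by simp
qed

text \<open>Left multiplication by the prescribed cycle \<open>c\<close> is a bijection:
  \<open>f\<close> agrees with \<open>c\<close> on \<open>xs\<close>, so
  \<open>inv c \<circ> f\<close> fixes \<open>xs\<close> pointwise and lives on the
  complement.\<close>

lemma card_permutations_tracing:
  assumes "finite A" "xs \<noteq> []" "distinct xs" "set xs \<subseteq> A"
  shows "card {f. f permutes A \<and> cycle_lengths A f = add_mset (length xs) M \<and> traces_cycle f xs}
       = card {\<rho>. \<rho> permutes (A - set xs) \<and> cycle_lengths (A - set xs) \<rho> = M}" (is "card ?F = card ?R")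
proof -
  define c where "c = cycle_of_list xs"
  note ext = extend_by_cycle[OF assms, folded c_def]
  have c: "c permutes set xs" unfolding c_def by (rule cycle_permutes)
  have rot: "map c xs = rotate1 xs" unfolding c_def using cyclic_rotation[OF assms(3), of 1] by simp
  have inv1: "inv c \<circ> (c \<circ> f) = f" "c \<circ> (inv c \<circ> f) = f" for f
    using permutes_inverses[OF c] by (auto simp: fun_eq_iff)
  have "bij_betw (\<lambda>\<rho>. c \<circ> \<rho>) ?R ?F"
  proof (rule bij_betw_byWitness[where f' = "\<lambda>f. inv c \<circ> f"])
    show "(\<lambda>\<rho>. c \<circ> \<rho>) ` ?R \<subseteq> ?F" using ext by auto
    show "(\<lambda>f. inv c \<circ> f) ` ?F \<subseteq> ?R"
    proof (rule image_subsetI)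
      fix f assume f: "f \<in> ?F"
      have "inv c permutes A" using c assms(4) by (intro permutes_inv permutes_subset[OF c])
      then have "(inv c \<circ> f) permutes A" using f by (intro permutes_compose) auto
      moreover have "(inv c \<circ> f) x = x" if "x \<in> set xs" for x
      proof -
        have "map f xs = map c xs" using f rot by (simp add: traces_cycle_def)
        then have "f x = c x" using that by (simp add: map_eq_conv)
        then show ?thesis using permutes_inverses[OF c] by simp
      qed
      ultimately have r: "(inv c \<circ> f) permutes (A - set xs)"
        by (rule permutes_superset) auto
      have "cycle_lengths (A - set xs) (inv c \<circ> f) = M"
        using ext(3)[OF r] f unfolding inv1 by simp
      then show "inv c \<circ> f \<in> ?R" using r by simp
    qed
  qed (use inv1 in auto)
  then show ?thesis by (simp add: bij_betw_same_card)
qed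

text \<open>\<open>hd\<close> matches the traces with the points on cycles of length
  \<open>m\<close>, because a trace is determined by its start.\<close>

lemma card_traces:
  assumes "f permutes A" "finite A"
  shows "card {xs. (length xs = m \<and> distinct xs \<and> set xs \<subseteq> A) \<and> traces_cycle f xs} = m * count (cycle_lengths A f) m"
    (is "card ?X = _")
proof -
  have "bij_betw hd ?X {x\<in>A. card (orbit_of f x) = m}"
    unfolding bij_betw_def
  proof (intro conjI set_eqI iffI)
    show "inj_on hd ?X" by (auto simp: inj_on_def intro: traces_cycle_unique)
    fix x assume "x \<in> hd ` ?X"
    then obtain xs where xs: "xs \<in> ?X" "x = hd xs" by auto
    then have "x \<in> set xs" by (auto simp: traces_cycle_def)
    then show "x \<in> {x\<in>A. card (orbit_of f x) = m}" using xs traces_cycle_card_orbit_of by auto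
  next
    fix x assume x: "x \<in> {x\<in>A. card (orbit_of f x) = m}"
    obtain xs where tr: "traces_cycle f (x # xs)" using traces_cycle_exists[OF assms] by blast
    have "set (x # xs) \<subseteq> A" using traces_cycle_subset[OF assms(1) tr] x by simp
    moreover have "length (x # xs) = m" using traces_cycle_card_orbit_of[OF tr, of x] x by simp
    ultimately have "x # xs \<in> ?X" using tr by (simp add: traces_cycle_def)
    then show "x \<in> hd ` ?X" by (rule image_eqI[rotated]) simp
  qed
  then show ?thesis using count_cycle_lengths[OF assms] by (simp add: bij_betw_same_card)
qed

lemma aut_Cons: "aut (m # \<beta>) = aut \<beta> * Suc (count (mset \<beta>) m)"
proof (cases "m \<in> set \<beta>")
  case True
  have "aut (m # \<beta>) = (\<Prod>i\<in>set \<beta>. fact (count (mset (m # \<beta>)) i))"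
    using True by (simp add: aut_def insert_absorb del: mset.simps)
  also have "\<dots> = fact (count (mset (m # \<beta>)) m) * (\<Prod>i\<in>set \<beta> - {m}. fact (count (mset (m # \<beta>)) i))"
    using True by (subst prod.remove[of _ m]) auto
  also have "(\<Prod>i\<in>set \<beta> - {m}. fact (count (mset (m # \<beta>)) i)) = (\<Prod>i\<in>set \<beta> - {m}. fact (count (mset \<beta>) i) :: nat)"
    by (intro prod.cong) auto
  also have "fact (count (mset (m # \<beta>)) m) * \<dots> = aut \<beta> * Suc (count (mset \<beta>) m)"
    unfolding aut_def using True by (subst (2) prod.remove[of _ m]) (auto simp: algebra_simps)
  finally show ?thesis .
next
  case False
  then have "count (mset \<beta>) m = 0" by (simp add: count_eq_zero_iff)
  moreover have "(\<Prod>i\<in>set \<beta>. fact (count (mset (m # \<beta>)) i)) = (\<Prod>i\<in>set \<beta>. fact (count (mset \<beta>) i) :: nat)"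
    using False by (intro prod.cong) auto
  ultimately show ?thesis using False by (simp add: aut_def del: count_mset_0_iff)
qed

text \<open>Induction on \<open>\<beta>\<close>: permutations together with a traced cycle of length \<open>m = hd \<beta>\<close> are counted in two ways.\<close>

lemma card_cycle_class:
  assumes "finite A" "\<forall>m\<in>set \<beta>. m > 0" "sum_list \<beta> = card A"
  shows "card {f. f permutes A \<and> cycle_lengths A f = mset \<beta>} * prod_list \<beta> * aut \<beta> = fact (card A)"
  using assms
proof (induction \<beta> arbitrary: A)
  case Nil
  then have "A = {}" by simp
  then show ?case by (simp add: aut_def cycle_lengths_def)
next
  case (Cons m \<beta>)
  let ?P = "{f. f permutes A \<and> cycle_lengths A f = add_mset m (mset \<beta>)}"
  let ?L = "{xs. length xs = m \<and> distinct xs \<and> set xs \<subseteq> A}"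
  let ?d = "card A"
  have m: "m > 0" "m \<le> ?d" using Cons.prems by auto
  have finP: "finite ?P" using finite_permutations[OF Cons.prems(1)] by (rule rev_finite_subset) auto
  have finL: "finite ?L"
    using finite_lists_length_eq[OF Cons.prems(1), of m] by (rule rev_finite_subset) auto
  \<comment> \<open>The number of members of the class that trace a given list of length
    \<open>m\<close>. By \<open>R\<close> below the division is exact and the result is the same for
    every list.\<close>
  define K where "K = fact (?d - m) div (prod_list \<beta> * aut \<beta>)"
  have pos: "prod_list \<beta> * aut \<beta> > 0"
    using Cons.prems(2) by (auto simp: aut_def prod_list_zero_iff intro!: Nat.gr0I)
  have R: "card {\<rho>. \<rho> permutes (A - set xs) \<and> cycle_lengths (A - set xs) \<rho> = mset \<beta>} * (prod_list \<beta> * aut \<beta>)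
             = fact (?d - m)" if "xs \<in> ?L" for xs
  proof -
    have "card (A - set xs) = ?d - m" using that Cons.prems(1)
      by (subst card_Diff_subset) (auto simp: distinct_card)
    then show ?thesis using Cons.IH[of "A - set xs"] Cons.prems by (simp add: mult.assoc)
  qed
  have K: "card {f\<in>?P. traces_cycle f xs} = K" if "xs \<in> ?L" for xs
  proof -
    have "{f\<in>?P. traces_cycle f xs} = {f. f permutes A \<and> cycle_lengths A f = add_mset (length xs) (mset \<beta>) \<and> traces_cycle f xs}"
      using that by auto
    then show ?thesis
      using card_permutations_tracing[of A xs "mset \<beta>"] that m Cons.prems(1) R[OF that, symmetric] pos
      by (auto simp: K_def)
  qed
  have "(\<Sum>f\<in>?P. card {xs\<in>?L. traces_cycle f xs}) = (\<Sum>xs\<in>?L. K)"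
    using K by (intro sum_multicount_gen finP finL) auto
  moreover have "(\<Sum>f\<in>?P. card {xs\<in>?L. traces_cycle f xs}) = (\<Sum>f\<in>?P. m * Suc (count (mset \<beta>) m))"
  proof (rule sum.cong[OF refl])
    fix f assume "f \<in> ?P"
    then show "card {xs\<in>?L. traces_cycle f xs} = m * Suc (count (mset \<beta>) m)"
      using card_traces[of f A m] Cons.prems(1) by simp
  qed
  ultimately have dc: "card ?P * (m * Suc (count (mset \<beta>) m)) = card ?L * K" by simp
  have L: "card ?L * fact (?d - m) = fact ?d"
    using card_lists_distinct_length_eq[OF Cons.prems(1) m(2)] fact_eq_fact_times[of "?d - m" ?d]
    by (simp add: mult.commute)
  \<comment> \<open>Some list is needed to conclude from \<open>R\<close> that the division in
    \<open>K\<close> is exact.\<close>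
  have "?L \<noteq> {}" using L by (metis card.empty fact_nonzero mult_zero_left)
  then obtain xs where "xs \<in> ?L" by blast
  from R[OF this] have KK: "K * (prod_list \<beta> * aut \<beta>) = fact (?d - m)" unfolding K_def
    by (metis dvd_triv_right dvd_div_mult_self)
  have "card ?P * prod_list (m # \<beta>) * aut (m # \<beta>) = card ?P * (m * Suc (count (mset \<beta>) m)) * (prod_list \<beta> * aut \<beta>)"
    by (simp add: aut_Cons mult_ac del: mult_Suc_right mult_Suc)
  also have "\<dots> = fact ?d" unfolding dc mult.assoc KK L ..
  finally show ?case by simp
qed

section \<open>Hyperbolic series and the cut-and-join equation\<close>

text \<open>This is 2 sinh(m x / 2), and the next series is 2 cosh(m x / 2); leaving out the halves
  accounts for the factors 2 in the identities below.\<close>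

definition sinh_fps :: "nat \<Rightarrow> real fps" where
  "sinh_fps m = fps_exp (real m / 2) - fps_exp (- (real m / 2))"

definition cosh_fps :: "nat \<Rightarrow> real fps" where
  "cosh_fps m = fps_exp (real m / 2) + fps_exp (- (real m / 2))"

text \<open>S(m x) in the notation of the overview, that is sinh(m x / 2) / (m x / 2).\<close>

definition sinhc_fps :: "nat \<Rightarrow> real fps" where
  "sinhc_fps m = Abs_fps (\<lambda>k. if even k then (real m / 2) ^ k / fact (k + 1) else 0)"

lemma sinh_fps_eq_sinhc: "sinh_fps m = fps_const (real m) * fps_X * sinhc_fps m"
proof (rule fps_ext)
  fix k show "fps_nth (sinh_fps m) k = fps_nth (fps_const (real m) * fps_X * sinhc_fps m) k"
  proof (cases k)
    case (Suc l)
    have "(- (real m / 2)) ^ Suc l = (if even l then - 1 else 1) * (real m / 2) ^ Suc l"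
      by (simp only: power_minus[of "real m / 2"]) simp
    then have "fps_nth (sinh_fps m) (Suc l) = (if even l then 2 * (real m / 2) ^ Suc l / fact (Suc l) else 0)"
      by (simp add: sinh_fps_def del: fact_Suc power_Suc)
    then show ?thesis using Suc by (simp add: sinhc_fps_def mult.assoc del: fact_Suc)
  qed (simp add: sinh_fps_def)
qed

lemma sinhc_fps_nth_0 [simp]: "fps_nth (sinhc_fps m) 0 = 1"
  by (simp add: sinhc_fps_def)

lemma sinh_fps_nonzero: "m > 0 \<Longrightarrow> sinh_fps m \<noteq> 0"
proof -
  assume "m > 0"
  then have "fps_nth (sinh_fps m) 1 \<noteq> 0" by (simp add: sinh_fps_def)
  then show ?thesis by auto
qed

lemma sinh_fps_deriv: "2 * fps_deriv (sinh_fps m) = of_nat m * cosh_fps m"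
proof -
  have "2 * fps_deriv (sinh_fps m) = fps_const 2 * fps_const (real m / 2) * cosh_fps m"
    by (simp add: sinh_fps_def cosh_fps_def numeral_fps_const algebra_simps del: fps_const_mult
        flip: fps_const_neg)
  also have "fps_const 2 * fps_const (real m / 2) = of_nat m" by (simp add: fps_of_nat)
  finally show ?thesis .
qed

lemma sinh_fps_add: "2 * sinh_fps (m + k) = cosh_fps m * sinh_fps k + sinh_fps m * cosh_fps k"
proof -
  have e: "fps_exp (real (m + k) / 2) = fps_exp (real m / 2) * fps_exp (real k / 2)"
    "fps_exp (- (real (m + k) / 2)) = fps_exp (- (real m / 2)) * fps_exp (- (real k / 2))"
    by (simp_all add: add_divide_distrib flip: fps_exp_add_mult)
  show ?thesis unfolding sinh_fps_def cosh_fps_def e by (simp add: algebra_simps)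
qed

text \<open>Each product of two sinh is a difference of two cosh. The one with argument
  \<open>m\<close> is the same for all \<open>i\<close>; the other, multiplied by
  \<open>sinh_fps 1\<close>, telescopes.\<close>

lemma sum_sinh_fps_convolution:
  assumes "m > 0"
  shows "sinh_fps 1 * (\<Sum>i\<in>{1..<m}. sinh_fps i * sinh_fps (m - i))
    = of_nat m * cosh_fps m * sinh_fps 1 - cosh_fps 1 * sinh_fps m"
proof -
  obtain l where l: "m = Suc l" using assms by (cases m) auto
  \<comment> \<open>This is 2 sinh((m - 2 i + 1) x / 2), written out because the argument may become
    negative, which \<open>sinh_fps\<close> does not admit.\<close>
  define T where "T i = fps_exp ((real m - 2 * real i + 1) / 2) - fps_exp (- ((real m - 2 * real i + 1) / 2))" for i :: nat
  have summand: "sinh_fps 1 * (sinh_fps i * sinh_fps (m - i)) = cosh_fps m * sinh_fps 1 - (T i - T (Suc i))"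
    if "i \<in> {1..<m}" for i
  proof -
    let ?a = "fps_exp (real i / 2)" and ?b = "fps_exp (- (real i / 2))"
    let ?c = "fps_exp (real (m - i) / 2)" and ?d = "fps_exp (- (real (m - i) / 2))"
    let ?p = "fps_exp (1 / 2 :: real)" and ?q = "fps_exp (- (1 / 2) :: real)"
    have mi: "real (m - i) = real m - real i" using that by auto
    have e: "?a * ?b = 1" "?c * ?d = 1" "?p * ?q = 1"
      by (simp_all flip: fps_exp_add_mult)
    have f: "fps_exp (real m / 2) = ?a * ?c" "fps_exp (- (real m / 2)) = ?b * ?d"
      unfolding fps_exp_add_mult[symmetric] mi by (simp_all add: field_simps)
    have t: "T i = ?b * ?c * ?p - ?a * ?d * ?q" "T (Suc i) = ?b * ?c * ?q - ?a * ?d * ?p"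
      unfolding T_def fps_exp_add_mult[symmetric] mi
      by (intro arg_cong2[of _ _ _ _ minus] arg_cong[of _ _ fps_exp]; simp add: field_simps)+
    show ?thesis
      unfolding t sinh_fps_def cosh_fps_def f by (simp add: algebra_simps)
  qed
  have "sinh_fps 1 * (\<Sum>i\<in>{1..<m}. sinh_fps i * sinh_fps (m - i))
      = (\<Sum>i\<in>{1..<m}. cosh_fps m * sinh_fps 1 - (T i - T (Suc i)))"
    unfolding sum_distrib_left using summand by (rule sum.cong[OF refl])
  also have "\<dots> = of_nat l * (cosh_fps m * sinh_fps 1) - (\<Sum>i\<in>{1..<m}. T i - T (Suc i))"
    by (simp add: sum_subtractf l)
  also have "(\<Sum>i\<in>{1..<m}. T i - T (Suc i)) = T 1 - T m"
    using sum_Suc_diff'[of 1 m T] assms by (simp add: sum_subtractf algebra_simps)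
  \<comment> \<open>\<open>T 1\<close> has argument \<open>m - 1\<close> and \<open>T m\<close> has
    argument \<open>1 - m\<close>; sinh is odd.\<close>
  also have "T 1 - T m = 2 * sinh_fps l"
    by (simp add: T_def sinh_fps_def l field_simps)
  also have "2 * sinh_fps l = cosh_fps 1 * sinh_fps m - cosh_fps m * sinh_fps 1"
  proof -
    let ?p = "fps_exp (1 / 2 :: real)" and ?q = "fps_exp (- (1 / 2) :: real)"
    have e: "fps_exp (real m / 2) = fps_exp (real l / 2) * ?p" "fps_exp (- (real m / 2)) = fps_exp (- (real l / 2)) * ?q"
      unfolding fps_exp_add_mult[symmetric] l by (simp_all add: field_simps)
    have pq: "?p * ?q = 1" by (simp flip: fps_exp_add_mult)
    have "cosh_fps 1 * sinh_fps m - cosh_fps m * sinh_fps 1 = 2 * (?p * ?q) * sinh_fps l"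
      unfolding sinh_fps_def cosh_fps_def e by (simp add: algebra_simps)
    then show ?thesis using pq by simp
  qed
  finally show ?thesis by (simp add: l algebra_simps)
qed

section \<open>The Laurent series attached to a permutation\<close>

definition sinh_fls :: "nat \<Rightarrow> real fls" where "sinh_fls m = fps_to_fls (sinh_fps m)"

text \<open>For positive \<open>m\<close> this has a simple pole at 0; it exists in the field of
  Laurent series, where nonzero factors also cancel.\<close>

definition coth_fls :: "nat \<Rightarrow> real fls" where
  "coth_fls m = fps_to_fls (cosh_fps m) / fps_to_fls (sinh_fps m)"

lemma sinh_fls_nonzero: "m > 0 \<Longrightarrow> sinh_fls m \<noteq> 0"
  by (simp add: sinh_fls_def sinh_fps_nonzero)

lemma sinh_fls_deriv: "m > 0 \<Longrightarrow> 2 * fls_deriv (sinh_fls m) = of_nat m * coth_fls m * sinh_fls m"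
  using arg_cong[OF sinh_fps_deriv[of m], of fps_to_fls] sinh_fps_nonzero[of m]
  by (simp add: sinh_fls_def coth_fls_def fls_deriv_fps_to_fls fls_times_fps_to_fls)

lemma sinh_fls_join:
  assumes "m > 0" "k > 0"
  shows "2 * sinh_fls (m + k) = (coth_fls m + coth_fls k) * (sinh_fls m * sinh_fls k)"
  using arg_cong[OF sinh_fps_add[of m k], of fps_to_fls] assms sinh_fps_nonzero
  by (simp add: sinh_fls_def coth_fls_def fls_times_fps_to_fls field_simps)

lemma fps_to_fls_sum: "fps_to_fls (sum h I) = (\<Sum>i\<in>I. fps_to_fls (h i))"
  by (induction I rule: infinite_finite_induct) auto

text \<open>The weights produced when a cycle of length \<open>m\<close> is cut at every position
  relative to a fixed point.\<close>

lemma sum_sinh_fls_convolution: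
  assumes "m > 0"
  shows "(\<Sum>i\<in>{1..<m}. sinh_fls i * sinh_fls (m - i)) = (of_nat m * coth_fls m - coth_fls 1) * sinh_fls m"
proof -
  have "sinh_fls 1 * (\<Sum>i\<in>{1..<m}. sinh_fls i * sinh_fls (m - i))
      = of_nat m * fps_to_fls (cosh_fps m) * sinh_fls 1 - fps_to_fls (cosh_fps 1) * sinh_fls m"
    using arg_cong[OF sum_sinh_fps_convolution[OF assms], of fps_to_fls]
    by (simp add: sinh_fls_def fls_times_fps_to_fls fps_to_fls_sum)
  also have "\<dots> = sinh_fls 1 * ((of_nat m * coth_fls m - coth_fls 1) * sinh_fls m)"
    using assms sinh_fps_nonzero[of m] sinh_fps_nonzero[of 1]
    by (simp add: sinh_fls_def coth_fls_def field_simps)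
  finally show ?thesis using sinh_fls_nonzero[of 1] by simp
qed

definition cycle_series :: "nat multiset \<Rightarrow> real fls" where
  "cycle_series M = (\<Prod>m\<in>#M. sinh_fls m) / sinh_fls 1"

text \<open>Logarithmic derivatives add over the product and subtract for the denominator, and that
  of \<open>sinh_fls m\<close> is half of \<open>m\<close> times coth.\<close>

lemma cycle_series_deriv:
  assumes "\<forall>m\<in>#M. m > 0"
  shows "2 * fls_deriv (cycle_series M) = cycle_series M * ((\<Sum>m\<in>#M. of_nat m * coth_fls m) - coth_fls 1)"
proof -
  let ?P = "\<Prod>m\<in>#M. sinh_fls m" and ?S = "\<Sum>m\<in>#M. of_nat m * coth_fls m"
  have P: "2 * fls_deriv ?P = ?P * ?S" using assms
  proof (induction M)
    case (add m M)
    let ?P = "\<Prod>m\<in>#M. sinh_fls m" and ?S = "\<Sum>m\<in>#M. of_nat m * coth_fls m"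
    have "2 * fls_deriv (sinh_fls m * ?P) = sinh_fls m * (2 * fls_deriv ?P) + (2 * fls_deriv (sinh_fls m)) * ?P"
      by (simp add: algebra_simps)
    also have "2 * fls_deriv ?P = ?P * ?S" using add by simp
    also have "2 * fls_deriv (sinh_fls m) = of_nat m * coth_fls m * sinh_fls m" using add by (simp add: sinh_fls_deriv)
    finally show ?case by (simp add: algebra_simps)
  qed simp
  have n1: "sinh_fls 1 \<noteq> 0" by (simp add: sinh_fls_nonzero)
  then have "?P = cycle_series M * sinh_fls 1" by (simp add: cycle_series_def)
  then have "2 * fls_deriv ?P = 2 * fls_deriv (cycle_series M) * sinh_fls 1 + cycle_series M * (2 * fls_deriv (sinh_fls 1))"
    by (simp add: algebra_simps)
  with P sinh_fls_deriv[of 1] have "2 * fls_deriv (cycle_series M) * sinh_fls 1 = cycle_series M * (?S - coth_fls 1) * sinh_fls 1"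
    using \<open>?P = _\<close> by (simp add: algebra_simps)
  then show ?thesis using n1 by simp
qed

text \<open>If \<open>b\<close> comes \<open>i\<close> steps after \<open>a\<close>, the cycle
  breaks into lengths \<open>i\<close> and \<open>m - i\<close>, so the sum over \<open>b\<close> is
  the convolution above.\<close>

lemma sum_over_orbit_cut:
  assumes f: "f permutes A" "finite A" "a \<in> A"
  defines "m \<equiv> card (orbit_of f a)"
  shows "(\<Sum>b\<in>orbit_of f a - {a}. cycle_series (cycle_lengths A (transpose a b \<circ> f)))
       = cycle_series (cycle_lengths A f) * (of_nat m * coth_fls m - coth_fls 1)"
proof -
  obtain ys where tr: "traces_cycle f (a # ys)" using traces_cycle_exists[OF f(1,2)] by blast
  let ?xs = "a # ys" and ?G = "cycle_series (cycle_lengths A f)"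
  have len: "length ?xs = m" using traces_cycle_card_orbit_of[OF tr, of a] by (simp add: m_def)
  have m: "m > 0" using len by auto
  have d: "distinct ?xs" using tr by (simp add: traces_cycle_def)
  have "bij_betw (\<lambda>i. ?xs ! i) {0..<m} (set ?xs)"
    using bij_betw_nth[OF d, of "{..<m}" "set ?xs"] len by (simp add: atLeast0LessThan del: list.set)
  then have "bij_betw (\<lambda>i. ?xs ! i) ({0..<m} - {0}) (set ?xs - {?xs ! 0})"
    using m by (intro bij_betw_DiffI bij_betw_singletonI) auto
  moreover have "{0..<m} - {0} = {1..<m}" by auto
  ultimately have bij: "bij_betw (\<lambda>i. ?xs ! i) {1..<m} (orbit_of f a - {a})"
    using traces_cycle_orbit_of[OF tr, of a] by simp
  have t: "cycle_series (cycle_lengths A (transpose a (?xs ! i) \<circ> f)) * sinh_fls m = ?G * (sinh_fls i * sinh_fls (m - i))"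
    if i: "i \<in> {1..<m}" for i
  proof -
    \<comment> \<open>In \<open>ys\<close> the point \<open>b\<close> has index
      \<open>i - 1\<close>: the half starting at \<open>a\<close> has \<open>i\<close> points and
      the half starting at \<open>b\<close> has \<open>m - i\<close>.\<close>
    let ?us = "take (i - 1) ys" and ?vs = "drop i ys"
    have il: "i - 1 < length ys" using i len by auto
    have b: "?xs ! i = ys ! (i - 1)" using i by (auto simp: nth_Cons')
    have "ys = ?us @ ?xs ! i # ?vs" unfolding b using id_take_nth_drop[OF il] i by simp
    then have tr': "traces_cycle f (a # ?us @ (?xs ! i) # ?vs)" using tr by metis
    have ml: "length ?us = i - 1" "length ?vs = m - i - 1" using il len by auto
    obtain M where M: "cycle_lengths A f = {#length ?us + length ?vs + 2#} + M"
      "cycle_lengths A (transpose a (?xs ! i) \<circ> f) = {#length ?us + 1, length ?vs + 1#} + M"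
      using cycle_lengths_cut[OF f tr'] by blast
    have "length ?us + length ?vs + 2 = m" "length ?us + 1 = i" "length ?vs + 1 = m - i"
      unfolding ml using i by auto
    with M have "cycle_lengths A f = {#m#} + M"
      "cycle_lengths A (transpose a (?xs ! i) \<circ> f) = {#i, m - i#} + M" by metis+
    then show ?thesis unfolding cycle_series_def by simp
  qed
  have "(\<Sum>b\<in>orbit_of f a - {a}. cycle_series (cycle_lengths A (transpose a b \<circ> f))) * sinh_fls m
    = (\<Sum>i\<in>{1..<m}. cycle_series (cycle_lengths A (transpose a (?xs ! i) \<circ> f)) * sinh_fls m)"
    by (subst sum.reindex_bij_betw[OF bij, symmetric]) (simp add: sum_distrib_right)
  also have "\<dots> = ?G * (\<Sum>i\<in>{1..<m}. sinh_fls i * sinh_fls (m - i))"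
    unfolding sum_distrib_left using t by (rule sum.cong[OF refl])
  also have "\<dots> = ?G * (of_nat m * coth_fls m - coth_fls 1) * sinh_fls m"
    using sum_sinh_fls_convolution[OF m] by simp
  finally show ?thesis using sinh_fls_nonzero[OF m] by simp
qed

text \<open>The factors of two cycles are replaced by the factor of their union, which the addition
  theorem for sinh expresses by coth.\<close>

lemma cycle_series_join:
  assumes f: "f permutes A" "finite A" "a \<in> A" "b \<in> A" "b \<notin> orbit_of f a"
  shows "2 * cycle_series (cycle_lengths A (transpose a b \<circ> f))
    = cycle_series (cycle_lengths A f) * (coth_fls (card (orbit_of f a)) + coth_fls (card (orbit_of f b)))"
proof -
  obtain M where M: "cycle_lengths A f = {#card (orbit_of f a), card (orbit_of f b)#} + M"
    "cycle_lengths A (transpose a b \<circ> f) = {#card (orbit_of f a) + card (orbit_of f b)#} + M"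
    using cycle_lengths_join[OF f] by blast
  have "2 * cycle_series (cycle_lengths A (transpose a b \<circ> f))
    = (2 * sinh_fls (card (orbit_of f a) + card (orbit_of f b))) * (\<Prod>m\<in>#M. sinh_fls m) / sinh_fls 1"
    unfolding M by (simp add: cycle_series_def)
  then show ?thesis
    unfolding M sinh_fls_join[OF card_orbit_of_pos[OF f(1,2)] card_orbit_of_pos[OF f(1,2)]]
    by (simp add: cycle_series_def mult_ac)
qed

section \<open>Summation over all transpositions\<close>

lemma cycle_lengths_pos:
  assumes "f permutes A" "finite A" shows "\<forall>m\<in>#cycle_lengths A f. m > 0"
  using assms card_orbit_of_pos[OF assms] by (auto simp: cycle_lengths_def)

text \<open>Let m(a) be the length of the cycle through \<open>a\<close> and \<kappa>(a) its coth.
  Up to the common factor \<open>?G\<close>, the cuts at \<open>a\<close> contribute m(a)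
  \<kappa>(a) - \<open>coth_fls 1\<close>, and each \<open>b\<close> on another cycle contributes
  half of \<kappa>(a) + \<kappa>(b). By symmetry the joins add up to the sum of (card A - m(a))
  \<kappa>(a), so m(a) cancels and a logarithmic derivative remains.\<close>

lemma cut_join_ordered:
  assumes f: "f permutes A" "finite A"
  shows "(\<Sum>a\<in>A. \<Sum>b\<in>A - {a}. cycle_series (cycle_lengths A (transpose a b \<circ> f)))
       = 2 * (of_nat (card A) * fls_deriv (cycle_series (cycle_lengths A f)))"
proof -
  let ?G = "cycle_series (cycle_lengths A f)" and ?F = "\<lambda>a b. cycle_series (cycle_lengths A (transpose a b \<circ> f))"
  define \<kappa> where "\<kappa> x = coth_fls (card (orbit_of f x))" for x
  define m where "m x = (of_nat (card (orbit_of f x)) :: real fls)" for x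
  have O: "orbit_of f a \<subseteq> A" if "a \<in> A" for a using orbit_of_permutes_subset[OF f(1) that] .
  have cO: "of_nat (card (A - orbit_of f a)) = of_nat (card A) - m a" if "a \<in> A" for a
  proof -
    have "finite (orbit_of f a)" using O[OF that] f(2) finite_subset by blast
    then show ?thesis using O[OF that] f(2) card_mono[of A "orbit_of f a"]
      by (simp add: m_def card_Diff_subset of_nat_diff)
  qed
  have row: "2 * (\<Sum>b\<in>A - {a}. ?F a b) = ?G * (2 * (m a * \<kappa> a - coth_fls 1) + (\<Sum>b\<in>A - orbit_of f a. \<kappa> a + \<kappa> b))"
    if a: "a \<in> A" for a
  proof -
    have "A - {a} = (orbit_of f a - {a}) \<union> (A - orbit_of f a)"
      using O[OF a] self_in_orbit_of[of a f] by blast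
    then have "(\<Sum>b\<in>A - {a}. ?F a b) = (\<Sum>b\<in>orbit_of f a - {a}. ?F a b) + (\<Sum>b\<in>A - orbit_of f a. ?F a b)"
      using f(2) O[OF a] by (simp add: sum.union_disjoint finite_subset Diff_Int_distrib)
        (subst sum.union_disjoint, auto intro: finite_subset)
    moreover have "2 * (\<Sum>b\<in>A - orbit_of f a. ?F a b) = ?G * (\<Sum>b\<in>A - orbit_of f a. \<kappa> a + \<kappa> b)"
      unfolding sum_distrib_left \<kappa>_def using cycle_series_join[OF f a] by (intro sum.cong) auto
    ultimately show ?thesis using sum_over_orbit_cut[OF f a]
      unfolding m_def \<kappa>_def by (simp only: distrib_left) (simp add: mult_ac)
  qed
  \<comment> \<open>Lying on different cycles is a symmetric relation, so \<open>a\<close> and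
    \<open>b\<close> may exchange roles.\<close>
  have swap: "(\<Sum>a\<in>A. \<Sum>b\<in>A - orbit_of f a. \<kappa> b) = (\<Sum>a\<in>A. \<Sum>b\<in>A - orbit_of f a. \<kappa> a)"
  proof -
    have sym: "b \<notin> orbit_of f a \<longleftrightarrow> a \<notin> orbit_of f b" for a b
      using orbit_of_eq[OF f] self_in_orbit_of by metis
    have "(\<Sum>a\<in>A. \<Sum>b\<in>A - orbit_of f a. \<kappa> b) = (\<Sum>a\<in>A. \<Sum>b\<in>A. if b \<notin> orbit_of f a then \<kappa> b else 0)"
      unfolding set_diff_eq using f(2) by (intro sum.cong[OF refl] sum.inter_filter)
    also have "\<dots> = (\<Sum>b\<in>A. \<Sum>a\<in>A. if a \<notin> orbit_of f b then \<kappa> b else 0)"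
      using sym by (subst sum.swap) (intro sum.cong refl if_cong, auto)
    also have "\<dots> = (\<Sum>a\<in>A. \<Sum>b\<in>A - orbit_of f a. \<kappa> a)"
      unfolding set_diff_eq using f(2) by (intro sum.cong[OF refl] sum.inter_filter[symmetric])
    finally show ?thesis .
  qed
  have "2 * (\<Sum>a\<in>A. \<Sum>b\<in>A - {a}. ?F a b)
      = ?G * (\<Sum>a\<in>A. 2 * (m a * \<kappa> a - coth_fls 1) + (\<Sum>b\<in>A - orbit_of f a. \<kappa> a + \<kappa> b))"
    unfolding sum_distrib_left using row by (intro sum.cong) (auto simp: sum_distrib_left)
  also have "(\<Sum>a\<in>A. 2 * (m a * \<kappa> a - coth_fls 1) + (\<Sum>b\<in>A - orbit_of f a. \<kappa> a + \<kappa> b))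
      = (\<Sum>a\<in>A. 2 * (m a * \<kappa> a - coth_fls 1)) + 2 * (\<Sum>a\<in>A. \<Sum>b\<in>A - orbit_of f a. \<kappa> a)"
    by (simp only: sum.distrib swap) simp
  also have "(\<Sum>a\<in>A. \<Sum>b\<in>A - orbit_of f a. \<kappa> a) = (\<Sum>a\<in>A. (of_nat (card A) - m a) * \<kappa> a)"
    using cO by (intro sum.cong) auto
  also have "(\<Sum>a\<in>A. 2 * (m a * \<kappa> a - coth_fls 1)) + 2 * \<dots> = (\<Sum>a\<in>A. 2 * (of_nat (card A) * \<kappa> a - coth_fls 1))"
    unfolding sum_distrib_left sum.distrib[symmetric] by (intro sum.cong) (auto simp: algebra_simps)
  also have "\<dots> = 2 * of_nat (card A) * ((\<Sum>a\<in>A. \<kappa> a) - coth_fls 1)"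
    by (simp add: sum_subtractf right_diff_distrib mult.assoc flip: sum_distrib_left)
  also have "(\<Sum>a\<in>A. \<kappa> a) = (\<Sum>k\<in>#cycle_lengths A f. of_nat k * coth_fls k)"
    using sum_orbits[OF f, of coth_fls] f(2)
    by (simp add: \<kappa>_def cycle_lengths_def sum_unfold_sum_mset image_mset.compositionality comp_def)
  also have "?G * (2 * of_nat (card A) * (\<dots> - coth_fls 1)) = 2 * of_nat (card A) * (2 * fls_deriv ?G)"
    using cycle_series_deriv[OF cycle_lengths_pos[OF f]] by simp
  finally show ?thesis by (simp add: comp_def)
qed

text \<open>Every transposition arises from two ordered pairs; \<open>P\<close> picks the increasing
  one.\<close>

lemma sum_transpositions:
  fixes F :: "(nat \<Rightarrow> nat) \<Rightarrow> 'a :: comm_ring_1"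
  shows "2 * (\<Sum>\<tau> | is_transposition_on d \<tau>. F \<tau>) = (\<Sum>a\<in>{0..<d}. \<Sum>b\<in>{0..<d} - {a}. F (transpose a b))"
proof -
  define P where "P = {(a, b). a < b \<and> b < d}"
  have fin: "finite P" by (rule finite_subset[of _ "{0..<d} \<times> {0..<d}"]) (auto simp: P_def)
  have inj: "inj_on (\<lambda>(a, b). transpose a b) P"
  proof (rule inj_onI, clarify)
    fix a b a' b' assume h: "(a, b) \<in> P" "(a', b') \<in> P" "transpose a b = transpose a' b'"
    have "transpose a' b' a = b" using h(3) by (metis transpose_apply_first)
    then show "a = a' \<and> b = b'" using h by (auto simp: P_def transpose_def split: if_splits)
  qed
  have T: "{\<tau>. is_transposition_on d \<tau>} = (\<lambda>(a, b). transpose a b) ` P" (is "?A = ?B")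
  proof
    show "?B \<subseteq> ?A" unfolding P_def is_transposition_on_def
      by clarify (metis less_trans less_irrefl)
    show "?A \<subseteq> ?B"
    proof
      fix \<tau> assume "\<tau> \<in> ?A"
      then obtain a b where ab: "a < d" "b < d" "a \<noteq> b" "\<tau> = transpose a b"
        by (auto simp: is_transposition_on_def)
      then have "(a, b) \<in> P \<or> (b, a) \<in> P" by (auto simp: P_def)
      then show "\<tau> \<in> ?B"
        using ab transpose_commute[of a b] by (metis (no_types, lifting) case_prod_conv image_eqI)
    qed
  qed
  have "(\<Sum>a\<in>{0..<d}. \<Sum>b\<in>{0..<d} - {a}. F (transpose a b))
      = (\<Sum>(a, b)\<in>Sigma {0..<d} (\<lambda>a. {0..<d} - {a}). F (transpose a b))"
    by (subst sum.Sigma) auto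
  also have "Sigma {0..<d} (\<lambda>a. {0..<d} - {a}) = P \<union> prod.swap ` P"
    by (auto simp: P_def image_iff)
  also have "(\<Sum>(a, b)\<in>P \<union> prod.swap ` P. F (transpose a b))
      = (\<Sum>(a, b)\<in>P. F (transpose a b)) + (\<Sum>(a, b)\<in>prod.swap ` P. F (transpose a b))"
    using fin by (intro sum.union_disjoint) (auto simp: P_def)
  also have "(\<Sum>(a, b)\<in>prod.swap ` P. F (transpose a b)) = (\<Sum>(a, b)\<in>P. F (transpose a b))"
    by (subst sum.reindex) (auto intro!: sum.cong simp: transpose_commute)
  also have "(\<Sum>(a, b)\<in>P. F (transpose a b)) = (\<Sum>\<tau> | is_transposition_on d \<tau>. F \<tau>)"
    unfolding T by (subst sum.reindex[OF inj]) (auto intro!: sum.cong)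
  finally show ?thesis by simp
qed

lemma cut_join:
  assumes "f permutes {0..<d}"
  shows "(\<Sum>\<tau> | is_transposition_on d \<tau>. cycle_series (cycle_lengths {0..<d} (\<tau> \<circ> f)))
       = of_nat d * fls_deriv (cycle_series (cycle_lengths {0..<d} f))"
proof -
  have "2 * (\<Sum>\<tau> | is_transposition_on d \<tau>. cycle_series (cycle_lengths {0..<d} (\<tau> \<circ> f)))
      = 2 * (of_nat d * fls_deriv (cycle_series (cycle_lengths {0..<d} f)))"
    unfolding sum_transpositions using cut_join_ordered[OF assms] by simp
  then show ?thesis by simp
qed

section \<open>One-part double Hurwitz numbers\<close>

lemma foldr_transpositions_permutes:
  assumes "\<forall>\<tau>\<in>set ts. is_transposition_on d \<tau>" "f permutes {0..<d}"
  shows "(foldr (\<circ>) ts id \<circ> f) permutes {0..<d}"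
  using assms(1)
proof (induction ts)
  case (Cons \<tau> ts)
  then have "\<tau> permutes {0..<d}" by (auto simp: is_transposition_on_def intro!: permutes_swap_id)
  moreover have "(foldr (\<circ>) ts id \<circ> f) permutes {0..<d}"
    by (rule Cons.IH) (use Cons.prems in simp)
  ultimately have "(\<tau> \<circ> (foldr (\<circ>) ts id \<circ> f)) permutes {0..<d}"
    by (rule permutes_compose[rotated])
  moreover have "foldr (\<circ>) (\<tau> # ts) id \<circ> f = \<tau> \<circ> (foldr (\<circ>) ts id \<circ> f)" by (rule ext) simp
  ultimately show ?case by metis
qed (use assms in simp)

lemma finite_transpositions: "finite {\<tau>. is_transposition_on d \<tau>}"
proof -
  have "{\<tau>. is_transposition_on d \<tau>} \<subseteq> (\<lambda>(a, b). transpose a b) ` ({0..<d} \<times> {0..<d})"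
    by (auto simp: is_transposition_on_def image_iff)
  then show ?thesis by (rule finite_subset) simp
qed

definition transposition_lists :: "nat \<Rightarrow> nat \<Rightarrow> (nat \<Rightarrow> nat) list set" where
  "transposition_lists d t = {ts. length ts = t \<and> (\<forall>\<tau>\<in>set ts. is_transposition_on d \<tau>)}"

lemma finite_transposition_lists: "finite (transposition_lists d t)"
proof -
  have "transposition_lists d t = {ts. set ts \<subseteq> {\<tau>. is_transposition_on d \<tau>} \<and> length ts = t}"
    by (auto simp: transposition_lists_def)
  then show ?thesis using finite_lists_length_eq[OF finite_transpositions] by simp
qed

lemma fls_deriv_of_nat_mult: "fls_deriv (of_nat k * F) = of_nat k * fls_deriv F"
  by simp

lemma cut_join_iterated:
  assumes "f permutes {0..<d}"
  shows "(\<Sum>ts\<in>transposition_lists d t. cycle_series (cycle_lengths {0..<d} (foldr (\<circ>) ts id \<circ> f)))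
       = of_nat (d ^ t) * (fls_deriv ^^ t) (cycle_series (cycle_lengths {0..<d} f))"
proof (induction t)
  case 0
  have "transposition_lists d 0 = {[]}" by (auto simp: transposition_lists_def)
  then show ?case by simp
next
  case (Suc t)
  let ?T = "{\<tau>. is_transposition_on d \<tau>}" and ?L = "transposition_lists d t"
  let ?G = "\<lambda>h. cycle_series (cycle_lengths {0..<d} h)"
  \<comment> \<open>The new transposition becomes the outermost factor, so that
    \<open>cut_join\<close> applies to the partial product; differentiation then commutes with the
    finite sum.\<close>
  have eq: "transposition_lists d (Suc t) = (\<lambda>(ts, \<tau>). \<tau> # ts) ` (?L \<times> ?T)"
    by (auto simp: transposition_lists_def length_Suc_conv image_iff)
  have "(\<Sum>ts\<in>transposition_lists d (Suc t). ?G (foldr (\<circ>) ts id \<circ> f))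
      = (\<Sum>(ts, \<tau>)\<in>?L \<times> ?T. ?G (\<tau> \<circ> (foldr (\<circ>) ts id \<circ> f)))"
    unfolding eq by (subst sum.reindex) (auto intro!: sum.cong simp: inj_on_def comp_assoc)
  also have "\<dots> = (\<Sum>ts\<in>?L. \<Sum>\<tau>\<in>?T. ?G (\<tau> \<circ> (foldr (\<circ>) ts id \<circ> f)))"
    by (simp add: sum.cartesian_product)
  also have "\<dots> = (\<Sum>ts\<in>?L. of_nat d * fls_deriv (?G (foldr (\<circ>) ts id \<circ> f)))"
    using foldr_transpositions_permutes[OF _ assms]
    by (intro sum.cong refl cut_join) (auto simp: transposition_lists_def)
  also have "\<dots> = of_nat d * fls_deriv (\<Sum>ts\<in>?L. ?G (foldr (\<circ>) ts id \<circ> f))"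
    by (simp add: fls_deriv_sum sum_distrib_left)
  also have "\<dots> = of_nat (d ^ Suc t) * (fls_deriv ^^ Suc t) (?G f)"
    unfolding Suc.IH fls_deriv_of_nat_mult by (simp add: mult.assoc)
  finally show ?case .
qed

section \<open>Coefficients of the cycle series\<close>

lemma fls_deriv_iter_nth_0: "fls_nth ((fls_deriv ^^ t) (F :: real fls)) 0 = fact t * fls_nth F (int t)"
  by (induction t arbitrary: F) (simp_all add: funpow_swap1 algebra_simps)

lemma sinh_fls_prod_mset:
  "(\<Prod>m\<in>#M. sinh_fls m) = fps_to_fls (fps_const (real (prod_mset M)) * fps_X ^ size M * (\<Prod>m\<in>#M. sinhc_fps m))"
  by (induction M)
    (simp_all add: sinh_fls_def sinh_fps_eq_sinhc fls_times_fps_to_fls mult_ac flip: fps_const_mult)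

text \<open>Since 2 sinh(m x / 2) = m x S(m x); one power of x cancels against the
  denominator.\<close>

lemma cycle_series_eq:
  assumes "M \<noteq> {#}"
  shows "cycle_series M = fps_to_fls (fps_const (real (prod_mset M)) * fps_X ^ (size M - 1)
    * ((\<Prod>m\<in>#M. sinhc_fps m) * inverse (sinhc_fps 1)))"
proof -
  have "sinh_fls 1 * fps_to_fls (fps_const (real (prod_mset M)) * fps_X ^ (size M - 1)
      * ((\<Prod>m\<in>#M. sinhc_fps m) * inverse (sinhc_fps 1)))
    = fps_to_fls (fps_const (real (prod_mset M)) * (fps_X * fps_X ^ (size M - 1))
      * (\<Prod>m\<in>#M. sinhc_fps m) * (inverse (sinhc_fps 1) * sinhc_fps 1))"
    by (simp add: sinh_fls_def sinh_fps_eq_sinhc mult_ac flip: fls_times_fps_to_fls)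
  also have "inverse (sinhc_fps 1) * sinhc_fps 1 = 1" by (rule inverse_mult_eq_1) simp
  also have "fps_X * fps_X ^ (size M - 1) = (fps_X :: real fps) ^ size M"
    using assms by (cases "size M") auto
  finally show ?thesis using sinh_fls_nonzero[of 1]
    by (simp add: cycle_series_def sinh_fls_prod_mset field_simps)
qed

text \<open>For n cycles and t = 2 g + n - 1 this turns [x^t] of the cycle series into a multiple of
  [x^(2 g)].\<close>

lemma cycle_series_nth:
  assumes "M \<noteq> {#}"
  shows "fls_nth (cycle_series M) (int k + int (size M) - 1)
    = real (prod_mset M) * fps_nth ((\<Prod>m\<in>#M. sinhc_fps m) * inverse (sinhc_fps 1)) k"
proof -
  have "size M > 0" using assms by (simp add: nonempty_has_size)
  then have k: "int k + int (size M) - 1 = int (size M - 1 + k)" by simp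
  have "fls_nth (fps_to_fls F) (int j) = fps_nth F j" for F :: "real fps" and j by simp
  then show ?thesis unfolding k cycle_series_eq[OF assms]
    by (simp add: mult.assoc fps_X_power_mult_nth del: of_nat_add)
qed

text \<open>The series begins with x^(r - 1), where r is the number of cycles, so only a single
  cycle has a constant term; its length is then \<open>d\<close>.\<close>

lemma cycle_series_nth_0:
  assumes "f permutes {0..<d}" "d > 0"
  shows "fls_nth (cycle_series (cycle_lengths {0..<d} f)) 0 = (if cycle_lengths {0..<d} f = {#d#} then real d else 0)"
proof -
  let ?M = "cycle_lengths {0..<d} f"
  have sum: "sum_mset ?M = d" using sum_mset_cycle_lengths[OF assms(1)] by simp
  then have ne: "?M \<noteq> {#}" using assms(2) by auto
  show ?thesis
  proof (cases "size ?M = 1")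
    case True
    then obtain k where "?M = {#k#}" using size_1_singleton_mset by blast
    then show ?thesis using cycle_series_nth[OF ne, of 0] sum by simp
  next
    case False
    then have "size ?M \<ge> 2" using ne by (metis One_nat_def Suc_1 Suc_leI less_Suc_eq nat_neq_iff nonempty_has_size not_less_eq)
    then show ?thesis using False unfolding cycle_series_eq[OF ne]
      by (auto simp: mult.assoc fps_X_power_mult_nth fps_mult_nth_0)
  qed
qed

text \<open>Constant coefficients of \<open>cut_join_iterated\<close>: on the left each list whose
  product with \<open>f\<close> is a \<open>d\<close>-cycle contributes \<open>d\<close>, and the
  others nothing.\<close>

lemma card_transposition_factorizations:
  assumes "f permutes {0..<d}" "d > 0"
  shows "real d * real (card {ts\<in>transposition_lists d t. cycle_lengths {0..<d} (foldr (\<circ>) ts id \<circ> f) = {#d#}})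
    = real d ^ t * fact t * fls_nth (cycle_series (cycle_lengths {0..<d} f)) (int t)"
proof -
  let ?G = "\<lambda>h. cycle_lengths {0..<d} h" and ?L = "transposition_lists d t"
  have "real d * real (card {ts\<in>?L. ?G (foldr (\<circ>) ts id \<circ> f) = {#d#}})
      = (\<Sum>ts\<in>?L. if ?G (foldr (\<circ>) ts id \<circ> f) = {#d#} then real d else 0)"
    using finite_transposition_lists by (simp add: sum.If_cases Int_def)
  also have "\<dots> = (\<Sum>ts\<in>?L. fls_nth (cycle_series (?G (foldr (\<circ>) ts id \<circ> f))) 0)"
    using foldr_transpositions_permutes[OF _ assms(1)] assms(2)
    by (intro sum.cong refl) (subst cycle_series_nth_0, auto simp: transposition_lists_def)
  also have "\<dots> = fls_nth (\<Sum>ts\<in>?L. cycle_series (?G (foldr (\<circ>) ts id \<circ> f))) 0"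
    by (simp add: fls_nth_sum)
  also have "\<dots> = real d ^ t * fact t * fls_nth (cycle_series (?G f)) (int t)"
    unfolding cut_join_iterated[OF assms(1)]
    by (simp add: fls_of_nat fls_deriv_iter_nth_0 flip: of_nat_power)
  finally show ?thesis .
qed

text \<open>The \<open>d\<close>-cycle is determined as the inverse of the remaining product, so
  only the transpositions and the last factor are free.\<close>

lemma hurwitz_count_eq:
  fixes \<beta> g
  assumes "g \<ge> 1"
  defines "d \<equiv> sum_list \<beta>" and "t \<equiv> 2 * g - 1 + length \<beta>"
  shows "hurwitz_count g \<beta> = (\<Sum>f | f permutes {0..<d} \<and> cycle_lengths {0..<d} f = mset \<beta>.
    card {ts\<in>transposition_lists d t. cycle_lengths {0..<d} (foldr (\<circ>) ts id \<circ> f) = {#d#}})"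
proof -
  let ?C = "{f. f permutes {0..<d} \<and> cycle_lengths {0..<d} f = mset \<beta>}"
  let ?D = "\<lambda>f. {ts\<in>transposition_lists d t. cycle_lengths {0..<d} (foldr (\<circ>) ts id \<circ> f) = {#d#}}"
  let ?X = "{(\<sigma>0, \<tau>s, \<sigma>1).
              \<sigma>0 permutes {0..<d} \<and> cycle_type d \<sigma>0 = {#d#} \<and>
              length \<tau>s = t \<and> (\<forall>\<tau>\<in>set \<tau>s. is_transposition_on d \<tau>) \<and>
              \<sigma>1 permutes {0..<d} \<and> cycle_type d \<sigma>1 = mset \<beta> \<and>
              \<sigma>0 \<circ> foldr (\<circ>) \<tau>s id \<circ> \<sigma>1 = id}"
  let ?h = "\<lambda>(f, ts). (inv (foldr (\<circ>) ts id \<circ> f), ts, f)"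
  have inj: "inj_on ?h (Sigma ?C ?D)" by (auto simp: inj_on_def)
  have "?X = ?h ` Sigma ?C ?D"
  proof (intro set_eqI iffI)
    fix x assume "x \<in> ?X"
    then obtain s0 ts f where x: "x = (s0, ts, f)" "(s0, ts, f) \<in> ?X" by (cases x) auto
    let ?p = "foldr (\<circ>) ts id \<circ> f"
    have p: "?p permutes {0..<d}" using x by (intro foldr_transpositions_permutes) auto
    have "s0 \<circ> ?p = id" using x by (simp add: comp_assoc)
    then have s0: "s0 = inv ?p"
      using permutes_inv_o(1)[OF p] by (metis comp_assoc comp_id id_comp)
    have "cycle_lengths {0..<d} ?p = {#d#}"
      using x cycle_lengths_inv[OF p] unfolding s0 by (simp add: cycle_type_eq_cycle_lengths)
    then have "(f, ts) \<in> Sigma ?C ?D" using x by (auto simp: transposition_lists_def cycle_type_eq_cycle_lengths)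
    then show "x \<in> ?h ` Sigma ?C ?D" by (rule image_eqI[rotated]) (simp add: x s0)
  next
    fix x assume "x \<in> ?h ` Sigma ?C ?D"
    then obtain f ts where x: "x = (inv (foldr (\<circ>) ts id \<circ> f), ts, f)" "f \<in> ?C" "ts \<in> ?D f" by auto
    let ?p = "foldr (\<circ>) ts id \<circ> f"
    have p: "?p permutes {0..<d}"
      using x by (intro foldr_transpositions_permutes) (auto simp: transposition_lists_def)
    have "inv ?p \<circ> foldr (\<circ>) ts id \<circ> f = id" using permutes_inv_o(2)[OF p] by (simp add: comp_assoc)
    then show "x \<in> ?X" using x permutes_inv[OF p] cycle_lengths_inv[OF p]
      by (auto simp: transposition_lists_def cycle_type_eq_cycle_lengths)
  qed
  moreover have "hurwitz_count g \<beta> = card ?X"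
    by (simp add: hurwitz_count_def d_def t_def Let_def)
  moreover have "finite ?C" using finite_permutations[of "{0..<d}"] by (rule rev_finite_subset) auto
  ultimately show ?thesis
    using finite_transposition_lists by (simp add: card_image[OF inj])
qed

text \<open>The number of transposition lists depends only on the cycle type. Class size,
  \<open>aut \<beta>\<close> and the factor \<open>prod_list \<beta>\<close> of the cycle series
  multiply to \<open>fact d\<close>, which the normalization of \<open>H_dd\<close> removes.\<close>

theorem one_part_double_hurwitz:
  assumes "g \<ge> 1" "\<beta> \<noteq> []" "\<forall>m\<in>set \<beta>. m > 0"
  shows "H_dd g \<beta> / (fact (2 * g + length \<beta> - 1) * real (sum_list \<beta>))
    = real (sum_list \<beta>) ^ (2 * g + length \<beta> - 3)
      * fps_nth ((\<Prod>m\<in>#mset \<beta>. sinhc_fps m) * inverse (sinhc_fps 1)) (2 * g)"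
proof -
  define d where "d = sum_list \<beta>"
  define t where "t = 2 * g - 1 + length \<beta>"
  let ?c = "fps_nth ((\<Prod>m\<in>#mset \<beta>. sinhc_fps m) * inverse (sinhc_fps 1)) (2 * g)"
  let ?C = "{f. f permutes {0..<d} \<and> cycle_lengths {0..<d} f = mset \<beta>}"
  have d: "d > 0" using assms(2,3) unfolding d_def by (cases \<beta>) auto
  \<comment> \<open>Of the power \<open>d ^ t\<close> one factor is absorbed by the weight
    \<open>d\<close> of the counted \<open>d\<close>-cycles and another by the division by
    \<open>d\<close>, leaving the exponent \<open>t - 2\<close>.\<close>
  obtain t' where t': "t = Suc (Suc t')" "t' = 2 * g + length \<beta> - 3" "t = 2 * g + length \<beta> - 1"
    using assms(1,2) that[of "2 * g + length \<beta> - 3"] by (cases \<beta>) (auto simp: t_def)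
  have "int t = int (2 * g) + int (size (mset \<beta>)) - 1" using assms(1) by (simp add: t_def)
  then have nth: "fls_nth (cycle_series (mset \<beta>)) (int t) = real (prod_list \<beta>) * ?c"
    using cycle_series_nth[of "mset \<beta>" "2 * g"] assms(2) by (simp add: prod_mset_prod_list)
  have "real d * real (hurwitz_count g \<beta>) = (\<Sum>f\<in>?C. real d ^ t * fact t * fls_nth (cycle_series (mset \<beta>)) (int t))"
    unfolding hurwitz_count_eq[OF assms(1), of \<beta>, folded d_def t_def] of_nat_sum sum_distrib_left
    using card_transposition_factorizations[OF _ d] by (intro sum.cong) auto
  then have H: "real d * real (hurwitz_count g \<beta>) = real (card ?C) * real d ^ t * fact t * (real (prod_list \<beta>) * ?c)"
    by (simp add: nth)
  have "card ?C * prod_list \<beta> * aut \<beta> = fact (card {0..<d})"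
    by (rule card_cycle_class) (use assms(3) d_def in auto)
  then have "real (card ?C * prod_list \<beta> * aut \<beta>) = real (fact d)"
    by (simp only: card_atLeastLessThan diff_zero)
  then have C: "real (card ?C) * real (prod_list \<beta>) * real (aut \<beta>) = fact d"
    by (simp only: of_nat_mult of_nat_fact)
  have "real d * (real (aut \<beta>) * real (hurwitz_count g \<beta>))
      = (real (card ?C) * real (prod_list \<beta>) * real (aut \<beta>)) * (real d ^ t * fact t * ?c)"
    using arg_cong[OF H, of "\<lambda>x. real (aut \<beta>) * x"] by (simp add: mult_ac)
  then have "real d * (real (aut \<beta>) * real (hurwitz_count g \<beta>)) = fact d * (real d ^ t * fact t * ?c)"
    unfolding C .
  then have "real (aut \<beta>) * real (hurwitz_count g \<beta>) = fact d * (real d ^ Suc t' * fact t * ?c)"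
    using d by (simp add: t'(1) del: fact_Suc)
  then have "H_dd g \<beta> = real d ^ Suc t' * fact t * ?c"
    unfolding H_dd_def d_def[symmetric] by (simp add: field_simps)
  then show ?thesis using d unfolding t'(2)[symmetric] t'(3)[symmetric] d_def[symmetric] by simp
qed

section \<open>Bernoulli numbers\<close>

definition bernoulli_fps :: "real fps" where
  "bernoulli_fps = fps_X / (fps_exp 1 - 1)"

lemma bernoulli_num_eq: "bernoulli_num r / fact r = fps_nth bernoulli_fps r"
  by (simp add: bernoulli_num_def bernoulli_fps_def)

text \<open>The quotient of series is a genuine one: e^x - 1 is x times the invertible series
  \<open>E\<close>.\<close>

lemma bernoulli_fps_times: "bernoulli_fps * (fps_exp 1 - 1) = fps_X"
proof -
  define E :: "real fps" where "E = Abs_fps (\<lambda>k. 1 / fact (k + 1))"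
  have E: "fps_exp 1 - 1 = fps_X * E"
  proof (rule fps_ext)
    fix k show "fps_nth (fps_exp 1 - 1) k = fps_nth (fps_X * E) k"
      by (cases k) (simp_all add: E_def del: fact_Suc)
  qed
  have "fps_X = (fps_exp 1 - 1) * inverse E"
    unfolding E mult.assoc by (subst inverse_mult_eq_1') (auto simp: E_def)
  then have "(fps_exp 1 - 1 :: real fps) dvd fps_X" by (rule dvdI)
  then show ?thesis unfolding bernoulli_fps_def by (rule dvd_div_mult_self)
qed

lemma exp_half_squared: "fps_exp (1/2 :: real) * fps_exp (1/2) = fps_exp 1"
  by (simp flip: fps_exp_add_mult)

text \<open>Because x S(x) e^(x/2) = e^x - 1.\<close>

lemma inverse_sinhc_eq_bernoulli: "inverse (sinhc_fps 1) = fps_exp (1/2) * bernoulli_fps"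
proof -
  have "fps_X * (sinhc_fps 1 * (fps_exp (1/2) * bernoulli_fps)) = sinh_fps 1 * fps_exp (1/2) * bernoulli_fps"
    by (simp add: sinh_fps_eq_sinhc mult_ac)
  also have "sinh_fps 1 * fps_exp (1/2) = fps_exp 1 - 1"
    unfolding sinh_fps_def left_diff_distrib by (simp flip: fps_exp_add_mult)
  also have "\<dots> * bernoulli_fps = fps_X * 1" using bernoulli_fps_times by (simp add: mult_ac)
  finally have "sinhc_fps 1 * (fps_exp (1/2) * bernoulli_fps) = 1"
    by (subst (asm) mult_cancel_left) auto
  then show ?thesis by (rule fps_inverse_unique)
qed

text \<open>With f = \<open>bernoulli_fps\<close>, 1 / S(x) = 2 f(x/2) - f(x), since e^x - 1 =
  (e^(x/2) - 1) (e^(x/2) + 1).\<close>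

lemma inverse_sinhc_nth: "fps_nth (inverse (sinhc_fps 1)) k = (2 / 2 ^ k - 1) * fps_nth bernoulli_fps k"
proof -
  let ?h = "bernoulli_fps oo (fps_const (1/2) * fps_X)"
  have nth: "fps_nth ?h k = fps_nth bernoulli_fps k / 2 ^ k" for k
    by (simp add: fps_compose_linear power_divide)
  have "(bernoulli_fps * (fps_exp 1 - 1)) oo (fps_const (1/2) * fps_X) = ?h * (fps_exp (1/2) - 1)"
    by (simp add: fps_compose_mult_distrib fps_compose_sub_distrib)
  then have h: "?h * (fps_exp (1/2) - 1) = fps_const (1/2) * fps_X"
    by (simp add: bernoulli_fps_times)
  have "(2 * ?h - bernoulli_fps) * (fps_exp 1 - 1) = 2 * (?h * (fps_exp (1/2) - 1)) * (fps_exp (1/2) + 1) - fps_X"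
    by (simp add: algebra_simps flip: exp_half_squared bernoulli_fps_times)
  also have "2 * (?h * (fps_exp (1/2) - 1)) = fps_X"
    unfolding h by (simp add: numeral_fps_const flip: mult.assoc)
  also have "fps_X * (fps_exp (1/2) + 1) - fps_X = fps_exp (1/2) * (bernoulli_fps * (fps_exp 1 - 1))"
    unfolding bernoulli_fps_times by (simp add: algebra_simps)
  finally have "(2 * ?h - bernoulli_fps) * (fps_exp 1 - 1) = (fps_exp (1/2) * bernoulli_fps) * (fps_exp 1 - 1)"
    by (simp add: mult.assoc)
  then have "inverse (sinhc_fps 1) = 2 * ?h - bernoulli_fps"
    unfolding inverse_sinhc_eq_bernoulli by (subst (asm) mult_cancel_right) auto
  then have "fps_nth (inverse (sinhc_fps 1)) k = 2 * fps_nth ?h k - fps_nth bernoulli_fps k"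
    by (simp add: numeral_fps_const)
  then show ?thesis unfolding nth by (simp add: left_diff_distrib)
qed

text \<open>Differentiate f (e^x - 1) = x, multiply by x and eliminate e^x.\<close>

lemma bernoulli_fps_deriv:
  "fps_X * fps_deriv bernoulli_fps = bernoulli_fps - bernoulli_fps\<^sup>2 - fps_X * bernoulli_fps"
proof -
  let ?f = bernoulli_fps and ?E = "fps_exp 1 :: real fps"
  note X = bernoulli_fps_times
  have "fps_deriv (?f * (?E - 1)) = 1" unfolding X by simp
  then have D: "fps_deriv ?f * (?E - 1) = 1 - ?f * ?E" by (simp add: algebra_simps)
  have "(fps_X * fps_deriv ?f) * (?E - 1) = fps_X * (1 - ?f * ?E)"
    unfolding mult.assoc D ..
  also have "\<dots> = fps_X - fps_X * ?f * (?E - 1) - ?f * fps_X" by (simp add: algebra_simps)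
  \<comment> \<open>Expanding the first and third \<open>fps_X\<close> as f (e^x - 1) exposes the
    common factor.\<close>
  also have "\<dots> = (?f - ?f\<^sup>2 - fps_X * ?f) * (?E - 1)"
    by (subst (1 3) X[symmetric]) (simp add: algebra_simps power2_eq_square)
  finally show ?thesis by (subst (asm) mult_cancel_right) auto
qed

text \<open>With \<open>h = x/(e\<^sup>x - 1) + x/2\<close> the differential equation becomes
  \<open>x h' = h - h\<^sup>2 + x\<^sup>2/4\<close>, a recurrence from which the signs of the coefficients can be read off.\<close>

lemma even_bernoulli_recurrence:
  defines "h \<equiv> bernoulli_fps + fps_const (1/2) * fps_X"
  assumes "k \<ge> 1"
  shows "(real k + 1) * fps_nth h k = (if k = 2 then 1/4 else 0) - (\<Sum>i\<in>{1..<k}. fps_nth h i * fps_nth h (k - i))"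
proof -
  have c: "fps_const (1/2) * fps_const (1/2) = (fps_const (1/4) :: real fps)" "fps_const (1/2) + fps_const (1/2) = (1 :: real fps)" by simp_all
  have ode: "fps_X * fps_deriv h = h - h\<^sup>2 + fps_const (1/4) * fps_X\<^sup>2"
  proof -
    have "fps_X * fps_deriv h = fps_X * fps_deriv bernoulli_fps + fps_const (1/2) * fps_X"
      by (simp add: h_def algebra_simps)
    also have "\<dots> = bernoulli_fps - bernoulli_fps\<^sup>2 - (fps_const (1/2) + fps_const (1/2)) * fps_X * bernoulli_fps + fps_const (1/2) * fps_X"
      unfolding bernoulli_fps_deriv by simp
    also have "\<dots> = h - h\<^sup>2 + fps_const (1/2) * fps_const (1/2) * fps_X\<^sup>2"
      unfolding h_def by (simp add: algebra_simps power2_eq_square del: fps_const_mult fps_const_add)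
    finally show ?thesis unfolding c .
  qed
  have h0: "fps_nth h 0 = 1"
  proof -
    have "fps_nth (bernoulli_fps * (fps_exp 1 - 1)) 1 = 1" unfolding bernoulli_fps_times by simp
    then show ?thesis by (simp add: fps_mult_nth h_def)
  qed
  have "fps_nth (h\<^sup>2) k = (\<Sum>i\<in>{0..k}. fps_nth h i * fps_nth h (k - i))"
    by (simp add: power2_eq_square fps_mult_nth)
  \<comment> \<open>Since the constant coefficient is 1, the end terms give 2 h_k; the coefficient
    identity k h_k = h_k - 2 h_k - ... then yields the factor \<open>k + 1\<close>.\<close>
  also have "{0..k} = insert 0 (insert k {1..<k})" using assms by auto
  also have "(\<Sum>i\<in>\<dots>. fps_nth h i * fps_nth h (k - i)) = 2 * fps_nth h k + (\<Sum>i\<in>{1..<k}. fps_nth h i * fps_nth h (k - i))"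
    using assms(2) h0 by simp
  finally have sq: "fps_nth (h\<^sup>2) k = 2 * fps_nth h k + (\<Sum>i\<in>{1..<k}. fps_nth h i * fps_nth h (k - i))" .
  have "real k * fps_nth h k = fps_nth (fps_X * fps_deriv h) k" using assms by (cases k) auto
  also have "\<dots> = fps_nth h k - fps_nth (h\<^sup>2) k + (if k = 2 then 1/4 else 0)"
    unfolding ode by (simp add: fps_X_power_iff)
  finally show ?thesis unfolding sq by (simp add: algebra_simps)
qed

text \<open>Strong induction on the recurrence. For odd \<open>k\<close> every product has a factor
  of odd index. For even \<open>k\<close> beyond 2 the products with even indices all have the sign
  (-1)^(k/2), which the minus before the sum reverses.\<close>

lemma even_bernoulli_signs:
  defines "h \<equiv> bernoulli_fps + fps_const (1/2) * fps_X"
  assumes "k \<ge> 1"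
  shows "(odd k \<longrightarrow> fps_nth h k = 0) \<and> (even k \<longrightarrow> (-1) ^ (k div 2) * fps_nth h k < 0)"
  using assms(2)
proof (induction k rule: less_induct)
  case (less k)
  note rec = even_bernoulli_recurrence[OF less.prems, folded h_def]
  let ?S = "\<Sum>i\<in>{1..<k}. fps_nth h i * fps_nth h (k - i)"
  show ?case
  proof (cases "odd k")
    case True
    have "fps_nth h i * fps_nth h (k - i) = 0" if "i \<in> {1..<k}" for i
    proof -
      have "odd i \<or> odd (k - i)" using True that by auto
      then show ?thesis using less.IH[of i] less.IH[of "k - i"] that by force
    qed
    then have "?S = 0" by (intro sum.neutral) auto
    then have "(real k + 1) * fps_nth h k = 0" using rec True by auto
    then show ?thesis using True by simp
  next
    case False
    then obtain l where l: "k = 2 * l" "l \<ge> 1" using less.prems by (auto elim!: evenE)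
    show ?thesis
    proof (cases "l = 1")
      case True
      \<comment> \<open>Here the convolution is h_1^2 = 0, and the inhomogeneous term gives h_2 =
        1/12.\<close>
      have "fps_nth h 1 = 0" using less.IH[of 1] l True by auto
      moreover have "{1..<2::nat} = {1}" by auto
      ultimately have "3 * fps_nth h 2 = 1/4" using rec l True by simp
      then show ?thesis using l True by simp
    next
      case l1: False
      have nn: "(-1) ^ l * (fps_nth h i * fps_nth h (k - i)) \<ge> 0 \<and>
          (even i \<longrightarrow> (-1) ^ l * (fps_nth h i * fps_nth h (k - i)) > 0)" if "i \<in> {1..<k}" for i
      proof (cases "even i")
        case True
        then obtain j where j: "i = 2 * j" by (auto elim: evenE)
        have "(-1) ^ j * fps_nth h i < 0" "(-1) ^ (l - j) * fps_nth h (k - i) < 0"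
          using less.IH[of i] less.IH[of "k - i"] that l j by (auto simp flip: diff_mult_distrib2)
        then have "((-1) ^ j * fps_nth h i) * ((-1) ^ (l - j) * fps_nth h (k - i)) > 0"
          by (rule mult_neg_neg)
        also have "((-1) ^ j * fps_nth h i) * ((-1) ^ (l - j) * fps_nth h (k - i))
            = (-1) ^ (j + (l - j)) * (fps_nth h i * fps_nth h (k - i))" by (simp add: power_add)
        also have "j + (l - j) = l" using that l j by auto
        finally show ?thesis by simp
      next
        case False
        then have "fps_nth h i = 0" using less.IH[of i] that by auto
        then show ?thesis using False by simp
      qed
      \<comment> \<open>Index 2 is available because \<open>k\<close> is at least 4, and its term
        makes the sum strictly positive.\<close>
      have "(-1) ^ l * ?S > 0" unfolding sum_distrib_left
        using l l1 nn by (intro sum_pos2[of _ 2]) auto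
      moreover have "(real k + 1) * fps_nth h k = - ?S" using rec l l1 by simp
      moreover have "(real k + 1) * ((-1) ^ l * fps_nth h k) = (-1) ^ l * ((real k + 1) * fps_nth h k)"
        by (simp only: mult_ac)
      ultimately have "(real k + 1) * ((-1) ^ l * fps_nth h k) < 0" by simp
      then have "(-1) ^ l * fps_nth h k < 0" by (simp add: mult_less_0_iff)
      then show ?thesis using l by simp
    qed
  qed
qed

text \<open>Keeps the part of lowest degree from vanishing. The linear term separating h from
  \<open>bernoulli_fps\<close> does not touch index 2 g, and 2^(1 - 2 g) is less than 1.\<close>

lemma inverse_sinhc_even_nonzero:
  assumes "g \<ge> 1" shows "fps_nth (inverse (sinhc_fps 1)) (2 * g) \<noteq> 0"
proof -
  have "fps_nth bernoulli_fps (2 * g) \<noteq> 0"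
    using even_bernoulli_signs[of "2 * g"] assms by auto
  moreover have "(2::real) < 2 ^ (2 * g)" using assms power_strict_increasing[of 1 "2 * g" "2::real"] by simp
  ultimately show ?thesis unfolding inverse_sinhc_nth by simp
qed

section \<open>The coefficients of the polynomial\<close>

text \<open>One factor of the product in \<open>Chat\<close>.\<close>

definition diff_poly :: "nat \<Rightarrow> real poly" where
  "diff_poly b = smult (1 / fact (b + 1)) ([:1, 1:] ^ (b + 1) - [:-1, 1:] ^ (b + 1))"

text \<open>The two binomial expansions differ by the sign (-1)^(b + 1 - j), so the terms with
  \<open>b - j\<close> odd cancel, as does x^(b + 1).\<close>

lemma coeff_diff_poly:
  "coeff (diff_poly b) j = (if j \<le> b \<and> even (b - j) then 2 / (fact j * fact (b - j + 1)) else 0)"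
proof (cases "j \<le> b")
  case True
  then have "coeff (diff_poly b) j = real (Suc b choose j) * (1 - (-1) ^ Suc (b - j)) / fact (Suc b)"
    by (simp add: diff_poly_def coeff_linear_poly_power Suc_diff_le right_diff_distrib diff_divide_distrib del: binomial_Suc_Suc power_Suc fact_Suc)
  also have "real (Suc b choose j) = fact (Suc b) / (fact j * fact (Suc (b - j)))"
    using True by (simp add: binomial_fact Suc_diff_le del: fact_Suc)
  finally show ?thesis using True by (simp del: fact_Suc)
next
  case False
  have "coeff ([:c, 1:] ^ (b + 1)) j = (if j = b + 1 then 1 else 0)" for c :: real
  proof (cases "j = b + 1")
    case j: False
    then show ?thesis using False degree_linear_power[of c "b + 1"] by (intro trans[OF coeff_eq_0]) auto
  qed (simp add: coeff_linear_power del: power_Suc)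
  then show ?thesis using False by (simp add: diff_poly_def del: power_Suc)
qed

lemma degree_diff_poly: "degree (diff_poly b) = b"
proof (rule antisym)
  show "degree (diff_poly b) \<le> b" by (rule degree_le) (simp add: coeff_diff_poly)
  show "b \<le> degree (diff_poly b)" by (rule le_degree) (simp add: coeff_diff_poly)
qed

lemma diff_poly_nonzero: "diff_poly b \<noteq> 0"
proof
  assume "diff_poly b = 0"
  then have "coeff (diff_poly b) b = 0" by simp
  then show False by (simp add: coeff_diff_poly)
qed

text \<open>The generating function of the \<open>diff_poly b\<close> is \<open>e\<^bsup>xz\<^esup> \<cdot> 2 sinh z / z\<close>; it is a power
  series in \<open>z\<close> over the polynomials in \<open>x\<close>.\<close>

definition poly_exp_fps :: "real \<Rightarrow> real poly fps" where
  "poly_exp_fps a = Abs_fps (\<lambda>k. monom (a ^ k / fact k) k)"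

definition diff_poly_fps :: "nat \<Rightarrow> real poly fps" where
  "diff_poly_fps m = Abs_fps (\<lambda>b. smult (real m ^ b) (diff_poly b))"

text \<open>The series F(2 z) with constant polynomials as coefficients; the doubling turns S(m z)
  into sinh(m z) / (m z).\<close>

definition const_poly_fps :: "real fps \<Rightarrow> real poly fps" where
  "const_poly_fps F = Abs_fps (\<lambda>k. [:2 ^ k * fps_nth F k:])"

lemma const_poly_fps_mult: "const_poly_fps (F * G) = const_poly_fps F * const_poly_fps G"
proof (rule fps_ext)
  fix k
  have "(\<Sum>i=0..k. [:2 ^ i * fps_nth F i:] * [:2 ^ (k - i) * fps_nth G (k - i):])
      = (\<Sum>i=0..k. [:2 ^ k * (fps_nth F i * fps_nth G (k - i)):])"
    by (intro sum.cong refl) (simp add: mult_ac flip: power_add)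
  also have "\<dots> = [:2 ^ k * (\<Sum>i=0..k. fps_nth F i * fps_nth G (k - i)):]"
    by (simp add: sum_distrib_left sum_to_poly)
  finally show "fps_nth (const_poly_fps (F * G)) k = fps_nth (const_poly_fps F * const_poly_fps G) k"
    by (simp add: const_poly_fps_def fps_mult_nth)
qed

lemma poly_exp_fps_add: "poly_exp_fps (a + b) = poly_exp_fps a * poly_exp_fps b"
proof (rule fps_ext)
  fix k
  have "(\<Sum>i=0..k. monom (a ^ i / fact i) i * monom (b ^ (k - i) / fact (k - i)) (k - i))
      = (\<Sum>i=0..k. monom (a ^ i / fact i * (b ^ (k - i) / fact (k - i))) k)"
    by (intro sum.cong refl) (simp add: mult_monom)
  also have "\<dots> = monom (\<Sum>i=0..k. a ^ i / fact i * (b ^ (k - i) / fact (k - i))) k"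
    by (intro poly_eqI) (simp add: coeff_sum)
  also have "(\<Sum>i=0..k. a ^ i / fact i * (b ^ (k - i) / fact (k - i))) = fps_nth (fps_exp a * fps_exp b) k"
    by (simp add: fps_mult_nth)
  also have "\<dots> = (a + b) ^ k / fact k" unfolding fps_exp_add_mult[symmetric] by simp
  finally show "fps_nth (poly_exp_fps (a + b)) k = fps_nth (poly_exp_fps a * poly_exp_fps b) k"
    by (simp add: poly_exp_fps_def fps_mult_nth)
qed

text \<open>The exponential contains x^i only together with z^i, so a single term of the Cauchy
  product survives.\<close>

lemma coeff_poly_exp_times_const:
  assumes "N \<le> s"
  shows "coeff (fps_nth (poly_exp_fps a * const_poly_fps F) s) N = a ^ N / fact N * (2 ^ (s - N) * fps_nth F (s - N))"
proof -
  have "coeff (fps_nth (poly_exp_fps a * const_poly_fps F) s) N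
      = (\<Sum>i\<in>{0..s}. if i = N then a ^ N / fact N * (2 ^ (s - N) * fps_nth F (s - N)) else 0)"
    unfolding fps_mult_nth coeff_sum
    by (intro sum.cong refl) (auto simp: poly_exp_fps_def const_poly_fps_def)
  then show ?thesis using assms by simp
qed

text \<open>The generating function with \<open>z\<close> scaled by \<open>m\<close>; the second
  factor is 2 sinh(m z) / (m z).\<close>

lemma diff_poly_fps_eq: "diff_poly_fps m = poly_exp_fps (real m) * const_poly_fps (2 * sinhc_fps m)"
proof (rule fps_ext, rule poly_eqI)
  fix b j
  show "coeff (fps_nth (diff_poly_fps m) b) j
      = coeff (fps_nth (poly_exp_fps (real m) * const_poly_fps (2 * sinhc_fps m)) b) j"
  proof (cases "j \<le> b")
    case True
    have "(real m / 2) ^ (b - j) * 2 ^ (b - j) = real m ^ (b - j)" by (simp add: power_divide)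
    moreover have "real m ^ b = real m ^ j * real m ^ (b - j)" using True by (simp flip: power_add)
    ultimately show ?thesis unfolding coeff_poly_exp_times_const[OF True]
      using True by (simp add: diff_poly_fps_def coeff_diff_poly sinhc_fps_def numeral_fps_const field_simps del: fact_Suc)
  next
    case False
    have "(\<Sum>i\<in>{0..b}. coeff (monom (real m ^ i / fact i) i * [:2 ^ (b - i) * fps_nth (2 * sinhc_fps m) (b - i):]) j) = 0"
      using False by (intro sum.neutral) auto
    then show ?thesis
      using False by (simp add: diff_poly_fps_def coeff_diff_poly fps_mult_nth poly_exp_fps_def const_poly_fps_def coeff_sum)
  qed
qed

lemma prod_diff_poly_fps:
  "(\<Prod>i<n. diff_poly_fps (f i)) = poly_exp_fps (real (\<Sum>i<n. f i)) * const_poly_fps (2 ^ n * (\<Prod>i<n. sinhc_fps (f i)))"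
proof (induction n)
  case 0
  have "poly_exp_fps 0 = 1" by (rule fps_ext) (auto simp: poly_exp_fps_def power_0_left one_pCons monom_0)
  moreover have "const_poly_fps 1 = 1" by (rule fps_ext) (auto simp: const_poly_fps_def one_pCons)
  ultimately show ?case by simp
next
  case (Suc n)
  have "(2 ^ Suc n * (\<Prod>i<Suc n. sinhc_fps (f i))) = (2 ^ n * (\<Prod>i<n. sinhc_fps (f i))) * (2 * sinhc_fps (f n))"
    by (simp add: mult_ac)
  then have "const_poly_fps (2 ^ Suc n * (\<Prod>i<Suc n. sinhc_fps (f i)))
      = const_poly_fps (2 ^ n * (\<Prod>i<n. sinhc_fps (f i))) * const_poly_fps (2 * sinhc_fps (f n))"
    by (simp only: const_poly_fps_mult)
  moreover have "poly_exp_fps (real (\<Sum>i<Suc n. f i)) = poly_exp_fps (real (\<Sum>i<n. f i)) * poly_exp_fps (real (f n))"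
    by (simp add: poly_exp_fps_add)
  ultimately show ?case
    unfolding prod.lessThan_Suc Suc.IH diff_poly_fps_eq[of "f n"] by (simp only: mult_ac)
qed

text \<open>Both sides are the coefficient of x^N z^s in the product of the
  \<open>diff_poly_fps (\<beta> ! i)\<close>: direct expansion runs over the exponent vectors of sum
  \<open>s\<close>, while in the closed form the exponentials merge into e^(d x z) with d =
  \<open>sum_list \<beta>\<close>.\<close>

lemma sum_monomials_diff_poly:
  assumes "length \<beta> = n" "n \<ge> 1" "N \<le> s"
  shows "(\<Sum>e\<in>natpermute s n. coeff (\<Prod>i<n. diff_poly (e ! i)) N * (\<Prod>i<n. real (\<beta> ! i) ^ (e ! i)))
    = real (sum_list \<beta>) ^ N / fact N * (2 ^ (s - N) * (2 ^ n * fps_nth (\<Prod>i<n. sinhc_fps (\<beta> ! i)) (s - N)))"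
proof -
  obtain n' where n': "n = Suc n'" using assms(2) by (cases n) auto
  have set: "{0..n'} = {..<n}" unfolding n' by auto
  have "fps_nth (\<Prod>i<n. diff_poly_fps (\<beta> ! i)) s
      = (\<Sum>e\<in>natpermute s n. \<Prod>i<n. smult (real (\<beta> ! i) ^ (e ! i)) (diff_poly (e ! i)))"
    using fps_prod_nth[of "\<lambda>i. diff_poly_fps (\<beta> ! i)" n' s] unfolding set
    by (simp add: n' diff_poly_fps_def)
  then have "coeff (fps_nth (\<Prod>i<n. diff_poly_fps (\<beta> ! i)) s) N
      = (\<Sum>e\<in>natpermute s n. coeff (\<Prod>i<n. diff_poly (e ! i)) N * (\<Prod>i<n. real (\<beta> ! i) ^ (e ! i)))"
    by (simp add: coeff_sum prod_smult mult.commute)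
  moreover have "(\<Sum>i<n. \<beta> ! i) = sum_list \<beta>" using assms(1) by (simp add: sum_list_sum_nth atLeast0LessThan)
  moreover have "fps_nth (2 ^ n * F) k = 2 ^ n * fps_nth F k" for F :: "real fps" and k
    by (simp add: numeral_fps_const fps_const_power)
  ultimately show ?thesis
    unfolding prod_diff_poly_fps coeff_poly_exp_times_const[OF assms(3)] by simp
qed

text \<open>\<open>N\<close> is the lowest degree and \<open>r\<close> the excess over it. The
  homogeneous part of degree \<open>N + r\<close> is \<open>sum_list \<beta> ^ N\<close> times [x^r]
  of the product of the S(\<beta>_i x), times the complementary coefficient of 1 / S. Dividing by
  2^(r + n) undoes the scaling in \<open>const_poly_fps\<close> and the factor 2 of each of the
  \<open>n\<close> series.\<close>

definition hurwitz_coeff :: "nat \<Rightarrow> nat \<Rightarrow> nat list \<Rightarrow> real" where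
  "hurwitz_coeff g n e = (let N = 2 * g + n - 3; r = sum_list e - N in
     if length e = n \<and> N \<le> sum_list e \<and> sum_list e \<le> N + 2 * g
     then fps_nth (inverse (sinhc_fps 1)) (2 * g - r) * fact N / 2 ^ (r + n) * coeff (\<Prod>i<n. diff_poly (e ! i)) N
     else 0)"

lemma hurwitz_coeff_eq:
  assumes "length e = n" "sum_list e = 2 * g + n - 3 + r" "r \<le> 2 * g"
  shows "hurwitz_coeff g n e = fps_nth (inverse (sinhc_fps 1)) (2 * g - r) * fact (2 * g + n - 3) / 2 ^ (r + n)
    * coeff (\<Prod>i<n. diff_poly (e ! i)) (2 * g + n - 3)"
  using assms by (simp add: hurwitz_coeff_def Let_def)

lemma hurwitz_coeff_nonzeroD:
  assumes "hurwitz_coeff g n e \<noteq> 0"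
  shows "length e = n" "2 * g + n - 3 \<le> sum_list e" "sum_list e \<le> 2 * g + n - 3 + 2 * g"
  using assms by (auto simp: hurwitz_coeff_def Let_def split: if_splits)

lemma hurwitz_coeff_support:
  "{e. hurwitz_coeff g n e \<noteq> 0} \<subseteq> (\<Union>r\<in>{0..2 * g}. natpermute (2 * g + n - 3 + r) n)"
proof
  fix e assume e: "e \<in> {e. hurwitz_coeff g n e \<noteq> 0}"
  note D = hurwitz_coeff_nonzeroD[of g n e]
  have "e \<in> natpermute (2 * g + n - 3 + (sum_list e - (2 * g + n - 3))) n"
    using D e by (simp add: natpermute_def)
  moreover have "sum_list e - (2 * g + n - 3) \<in> {0..2 * g}" using D e by simp
  ultimately show "e \<in> (\<Union>r\<in>{0..2 * g}. natpermute (2 * g + n - 3 + r) n)" by (rule UN_I[rotated])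
qed

text \<open>The exponent vectors are sorted by degree \<open>N + r\<close>; for each
  \<open>r\<close> the sum is known, and the sum over \<open>r\<close> is the Cauchy product at x^(2
  g).\<close>

lemma poly_eval_hurwitz_coeff:
  assumes "length \<beta> = n" "n \<ge> 1"
  shows "poly_eval (hurwitz_coeff g n) \<beta> = real (sum_list \<beta>) ^ (2 * g + n - 3)
      * fps_nth ((\<Prod>m\<in>#mset \<beta>. sinhc_fps m) * inverse (sinhc_fps 1)) (2 * g)"
proof -
  define N where "N = 2 * g + n - 3"
  let ?c = "hurwitz_coeff g n" and ?m = "\<lambda>e. \<Prod>i<n. real (\<beta> ! i) ^ (e ! i)"
  let ?a = "fps_nth (inverse (sinhc_fps 1))" and ?P = "\<Prod>i<n. sinhc_fps (\<beta> ! i)"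
  have "poly_eval ?c \<beta> = (\<Sum>e\<in>(\<Union>r\<in>{0..2 * g}. natpermute (N + r) n). ?c e * ?m e)"
    unfolding poly_eval_def assms(1) N_def using hurwitz_coeff_support
    by (intro sum.mono_neutral_left) (auto simp: natpermute_finite)
  also have "\<dots> = (\<Sum>r\<in>{0..2 * g}. \<Sum>e\<in>natpermute (N + r) n. ?c e * ?m e)"
    by (intro sum.UNION_disjoint ballI natpermute_finite) (auto simp: natpermute_def)
  also have "\<dots> = (\<Sum>r\<in>{0..2 * g}. real (sum_list \<beta>) ^ N * (fps_nth ?P r * ?a (2 * g - r)))"
  proof (intro sum.cong refl)
    fix r assume r: "r \<in> {0..2 * g}"
    have "(\<Sum>e\<in>natpermute (N + r) n. ?c e * ?m e)
        = (\<Sum>e\<in>natpermute (N + r) n. ?a (2 * g - r) * fact N / 2 ^ (r + n) * (coeff (\<Prod>i<n. diff_poly (e ! i)) N * ?m e))"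
      using r by (intro sum.cong refl) (simp add: natpermute_def N_def hurwitz_coeff_eq)
    also have "\<dots> = ?a (2 * g - r) * fact N / 2 ^ (r + n) * (real (sum_list \<beta>) ^ N / fact N * (2 ^ r * (2 ^ n * fps_nth ?P r)))"
      unfolding sum_distrib_left[symmetric] using sum_monomials_diff_poly[OF assms, of N "N + r"] by simp
    also have "\<dots> = real (sum_list \<beta>) ^ N * (fps_nth ?P r * ?a (2 * g - r))"
      by (simp add: power_add)
    finally show "(\<Sum>e\<in>natpermute (N + r) n. ?c e * ?m e) = real (sum_list \<beta>) ^ N * (fps_nth ?P r * ?a (2 * g - r))" .
  qed
  also have "\<dots> = real (sum_list \<beta>) ^ N * fps_nth (?P * inverse (sinhc_fps 1)) (2 * g)"
    by (simp add: fps_mult_nth sum_distrib_left)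
  also have "?P = prod_list (map sinhc_fps \<beta>)"
    using assms(1) by (auto simp: prod.list_conv_set_nth atLeast0LessThan)
  also have "\<dots> = (\<Prod>m\<in>#mset \<beta>. sinhc_fps m)"
    by (simp flip: prod_mset_prod_list)
  finally show ?thesis by (simp add: N_def)
qed

lemma prod_diff_poly_list: "length e = n \<Longrightarrow> (\<Prod>i<n. diff_poly (e ! i)) = prod_list (map diff_poly e)"
  by (auto simp: prod.list_conv_set_nth atLeast0LessThan)

lemma symmetric_hurwitz_coeff: "symmetric_coeffs n (hurwitz_coeff g n)"
  unfolding symmetric_coeffs_def
proof (intro allI impI)
  fix p and e :: "nat list" assume "p permutes {..<n} \<and> length e = n"
  then have p: "p permutes {..<length e}" "length e = n" by auto
  have m: "mset (permute_list p e) = mset e" using mset_permute_list[OF p(1)] .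
  have s: "sum_list (permute_list p e) = sum_list e" using m by (metis sum_mset_sum_list)
  have "prod_list (map diff_poly (permute_list p e)) = prod_list (map diff_poly e)"
    using m by (metis mset_map prod_mset_prod_list)
  then show "hurwitz_coeff g n (permute_list p e) = hurwitz_coeff g n e"
    using prod_diff_poly_list[of "permute_list p e" n] prod_diff_poly_list[of e n] p(2)
    by (simp add: hurwitz_coeff_def s Let_def)
qed

text \<open>With the whole exponent on one variable, all other factors are the constant 2. Used with
  r = 0 and r = 2 g for the two extreme degrees.\<close>

lemma hurwitz_coeff_nonzero:
  assumes "n \<ge> 1" "even r" "r \<le> 2 * g" "fps_nth (inverse (sinhc_fps 1)) (2 * g - r) \<noteq> 0"
  shows "hurwitz_coeff g n ((2 * g + n - 3 + r) # replicate (n - 1) 0) \<noteq> 0"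
proof -
  let ?N = "2 * g + n - 3" and ?e = "(2 * g + n - 3 + r) # replicate (n - 1) 0"
  have len: "length ?e = n" using assms(1) by simp
  have "diff_poly 0 = [:2:]" by (simp add: diff_poly_def)
  then have "prod_list (map diff_poly ?e) = smult (2 ^ (n - 1)) (diff_poly (?N + r))"
    by (simp add: map_replicate_const poly_const_pow)
  then have "coeff (prod_list (map diff_poly ?e)) ?N = 2 ^ (n - 1) * (2 / (fact ?N * fact (r + 1)))"
    using assms(2) by (simp add: coeff_diff_poly del: fact_Suc)
  then show ?thesis
    using hurwitz_coeff_eq[OF len, of g r] assms(3,4) prod_diff_poly_list[OF len] by (simp del: fact_Suc)
qed

section \<open>Comparison with the closed form\<close>

lemma Chat_eq:
  assumes "length bs = n"
  shows "Chat g bs = fact (2 * g + n - 3) * fact (nat (int (sum_list bs) + 3 - 2 * int g))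
    * coeff (\<Prod>i<n. diff_poly (bs ! i)) (2 * g + n - 3)"
  using assms by (simp add: Chat_def diff_poly_def Let_def)

lemma degree_prod_diff_poly:
  assumes "length bs = n" shows "degree (\<Prod>i<n. diff_poly (bs ! i)) = sum_list bs"
  using assms by (simp add: degree_prod_eq_sum_degree diff_poly_nonzero degree_diff_poly sum_list_sum_nth atLeast0LessThan)

text \<open>After a shift by \<open>K\<close> the sum is the Cauchy product of e^(x/2) and
  \<open>bernoulli_fps\<close>, hence a coefficient of 1 / S.\<close>

lemma C_const_eq:
  assumes "K + 2 * k = 2 * g + n" "int b + 3 - 2 * int g = int K"
  shows "C_const b g n = fps_nth (inverse (sinhc_fps 1)) (2 * k) / (fact K * 2 ^ K)"
proof -
  let ?f = "fps_nth bernoulli_fps"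
  have arg: "int i + 2 * int g - int b - 3 = int i - int K" for i using assms(2) by simp
  have "(\<Sum>i=0..2*g+n. inv_fact (int i + 2 * int g - int b - 3) * bernoulli_num (2*g+n-i) / (fact (2*g+n-i) * 2 ^ i))
      = (\<Sum>i=0..2*g+n. inv_fact (int i - int K) * ?f (2*g+n-i) / 2 ^ i)"
    unfolding arg bernoulli_num_eq[symmetric] by (simp add: field_simps)
  \<comment> \<open>Below \<open>K\<close> the reciprocal factorial has a negative argument and is 0
    by convention.\<close>
  also have "\<dots> = (\<Sum>i=K..2*g+n. inv_fact (int i - int K) * ?f (2*g+n-i) / 2 ^ i)"
    by (rule sum.mono_neutral_right) (auto simp: inv_fact_def)
  also have "\<dots> = (\<Sum>j=0..2*k. inv_fact (int (j + K) - int K) * ?f (2*g+n-(j+K)) / 2 ^ (j + K))"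
    using sum.shift_bounds_cl_nat_ivl[of "\<lambda>i. inv_fact (int i - int K) * ?f (2*g+n-i) / 2 ^ i" 0 K "2 * k"] assms(1)
    by (simp add: add.commute)
  also have "\<dots> = (\<Sum>j=0..2*k. ((1/2) ^ j / fact j * ?f (2 * k - j)) / 2 ^ K)"
  proof (intro sum.cong refl)
    fix j assume "j \<in> {0..2 * k}"
    have "2 * g + n - (j + K) = 2 * k - j" using assms(1) by simp
    then show "inv_fact (int (j + K) - int K) * ?f (2*g+n-(j+K)) / 2 ^ (j + K) = ((1/2) ^ j / fact j * ?f (2 * k - j)) / 2 ^ K"
      by (simp add: inv_fact_def power_add power_one_over field_simps)
  qed
  also have "\<dots> = fps_nth (inverse (sinhc_fps 1)) (2 * k) / 2 ^ K"
    unfolding inverse_sinhc_eq_bernoulli by (simp add: fps_mult_nth sum_divide_distrib)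
  finally show ?thesis
    unfolding C_const_def assms(2) by (simp add: inv_fact_def mult.commute)
qed

text \<open>For k up to g the excess degree is r = 2 (g - k), so 2 g - r = 2 k and K = r + n; the
  factorial of \<open>K\<close> in \<open>Chat\<close> cancels the one in \<open>C_const\<close>.
  For larger k both sides are 0.\<close>

lemma hurwitz_coeff_eq_C:
  assumes "g \<ge> 1" "n \<ge> 1" "length bs = n" "int (sum_list bs) \<ge> 2 * int g - 3" "sum_list bs + 2 * k = 4 * g + n - 3"
  shows "hurwitz_coeff g n bs = C_const (sum_list bs) g n * Chat g bs"
proof (cases "k \<le> g")
  case True
  define K where "K = 2 * (g - k) + n"
  have K: "K + 2 * k = 2 * g + n" "int (sum_list bs) + 3 - 2 * int g = int K"
    using True assms by (auto simp: K_def)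
  have "sum_list bs = 2 * g + n - 3 + 2 * (g - k)" using True assms by auto
  then have "hurwitz_coeff g n bs = fps_nth (inverse (sinhc_fps 1)) (2 * k) * fact (2 * g + n - 3) / 2 ^ K
    * coeff (\<Prod>i<n. diff_poly (bs ! i)) (2 * g + n - 3)"
    using hurwitz_coeff_eq[OF assms(3), of g "2 * (g - k)"] True by (simp add: K_def right_diff_distrib')
  then show ?thesis
    unfolding C_const_eq[OF K] Chat_eq[OF assms(3)] K(2) by simp
next
  case False
  \<comment> \<open>The total degree is now below the lowest one, and also below the index of the
    coefficient that \<open>Chat\<close> extracts.\<close>
  then have lt: "sum_list bs < 2 * g + n - 3" using assms by auto
  then have "coeff (\<Prod>i<n. diff_poly (bs ! i)) (2 * g + n - 3) = 0"
    using degree_prod_diff_poly[OF assms(3)] by (intro coeff_eq_0) simp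
  then show ?thesis using lt unfolding Chat_eq[OF assms(3)] by (simp add: hurwitz_coeff_def)
qed

text \<open>Here r = 0 and the extracted coefficient is the leading one, the product of the leading
  coefficients 2 / b_i!; this produces the multinomial coefficient.\<close>

lemma hurwitz_coeff_lowest:
  assumes "g \<ge> 1" "length bs = n" "sum_list bs = 2 * g + n - 3"
  shows "hurwitz_coeff g n bs = multinomial_coeff bs * (1 - 2 ^ (2*g-1)) / (2 ^ (2*g-1) * fact (2*g)) * bernoulli_num (2*g)"
proof -
  let ?N = "2 * g + n - 3"
  have "coeff (\<Prod>i<n. diff_poly (bs ! i)) ?N = (\<Prod>i<n. coeff (diff_poly (bs ! i)) (bs ! i))"
    using lead_coeff_prod[of "\<lambda>i. diff_poly (bs ! i)" "{..<n}"] degree_prod_diff_poly[OF assms(2)] assms(3)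
    by (simp add: degree_diff_poly)
  also have "\<dots> = 2 ^ n / (\<Prod>i<n. fact (bs ! i))"
    by (simp add: coeff_diff_poly prod_dividef)
  finally have "hurwitz_coeff g n bs = fps_nth (inverse (sinhc_fps 1)) (2 * g) * multinomial_coeff bs"
    using hurwitz_coeff_eq[OF assms(2), of g 0] assms(2,3) by (simp add: multinomial_coeff_def)
  also have "fps_nth (inverse (sinhc_fps 1)) (2 * g) = (2 / 2 ^ (2 * g) - 1) * (bernoulli_num (2 * g) / fact (2 * g))"
    unfolding inverse_sinhc_nth bernoulli_num_eq ..
  also have "(2::real) / 2 ^ (2 * g) - 1 = (1 - 2 ^ (2*g-1)) / 2 ^ (2*g-1)"
    using assms(1) by (cases g) (auto simp: field_simps)
  finally show ?thesis by simp
qed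

theorem theorem3p8:
  fixes g n :: nat
  assumes "g \<ge> 1" and "n \<ge> 1"
  shows "\<exists>c. is_poly_coeffs n c \<and>
     (\<forall>\<beta>. length \<beta> = n \<and> (\<forall>i\<in>set \<beta>. i > 0) \<longrightarrow>
        H_dd g \<beta> / (fact (2*g+n-1) * real (sum_list \<beta>)) = poly_eval c \<beta>) \<and>
     symmetric_coeffs n c \<and>
     (\<exists>e. c e \<noteq> 0 \<and> sum_list e = 4*g+n-3) \<and> (\<forall>e. c e \<noteq> 0 \<longrightarrow> sum_list e \<le> 4*g+n-3) \<and>
     (\<exists>e. c e \<noteq> 0 \<and> sum_list e = 2*g+n-3) \<and> (\<forall>e. c e \<noteq> 0 \<longrightarrow> sum_list e \<ge> 2*g+n-3) \<and>
     (\<forall>bs k. length bs = n \<and> int (sum_list bs) \<ge> 2 * int g - 3 \<and>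
        sum_list bs + 2 * k = 4*g+n-3 \<longrightarrow>
        (-1) ^ ((4*g-3+n - sum_list bs) div 2) * dbracket c g bs k
          = C_const (sum_list bs) g n * Chat g bs) \<and>
     (\<forall>bs k. length bs = n \<and> even (sum_list bs + n) \<longrightarrow> dbracket c g bs k = 0) \<and>
     (\<forall>bs. length bs = n \<and> sum_list bs = 2*g+n-3 \<longrightarrow>
        dbracket c g bs g = (-1) ^ g * multinomial_coeff bs *
          (1 - 2 ^ (2*g-1)) / (2 ^ (2*g-1) * fact (2*g)) * bernoulli_num (2*g))"
proof (intro exI[of _ "hurwitz_coeff g n"] conjI allI impI)
  let ?c = "hurwitz_coeff g n"
  show "is_poly_coeffs n ?c"
    unfolding is_poly_coeffs_def
    using finite_subset[OF hurwitz_coeff_support] hurwitz_coeff_nonzeroD(1) by (auto simp: natpermute_finite)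
  show "H_dd g \<beta> / (fact (2*g+n-1) * real (sum_list \<beta>)) = poly_eval ?c \<beta>"
    if "length \<beta> = n \<and> (\<forall>i\<in>set \<beta>. i > 0)" for \<beta>
  proof -
    have "length \<beta> = n" "\<beta> \<noteq> []" using that assms(2) by auto
    then show ?thesis using one_part_double_hurwitz[OF assms(1), of \<beta>] that
      unfolding poly_eval_hurwitz_coeff[OF \<open>length \<beta> = n\<close> assms(2)] by metis
  qed
  show "symmetric_coeffs n ?c" by (rule symmetric_hurwitz_coeff)
  \<comment> \<open>Top degree, r = 2 g: the constant coefficient of 1 / S is 1.\<close>
  have "?c ((2 * g + n - 3 + 2 * g) # replicate (n - 1) 0) \<noteq> 0"
    using assms(2) by (intro hurwitz_coeff_nonzero) auto
  then show "\<exists>e. ?c e \<noteq> 0 \<and> sum_list e = 4*g+n-3"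
    by (rule_tac exI, intro conjI, assumption) (use assms in \<open>auto simp: sum_list_replicate\<close>)
  \<comment> \<open>Lowest degree, r = 0: rests on B_(2 g) being nonzero.\<close>
  have "?c ((2 * g + n - 3 + 0) # replicate (n - 1) 0) \<noteq> 0"
    using assms inverse_sinhc_even_nonzero[OF assms(1)] by (intro hurwitz_coeff_nonzero) auto
  then show "\<exists>e. ?c e \<noteq> 0 \<and> sum_list e = 2*g+n-3"
    by (rule_tac exI, intro conjI, assumption) (auto simp: sum_list_replicate)
  show "sum_list e \<le> 4*g+n-3" "2*g+n-3 \<le> sum_list e" if "?c e \<noteq> 0" for e
    using hurwitz_coeff_nonzeroD[OF that] assms by auto
  show "(-1) ^ ((4*g-3+n - sum_list bs) div 2) * dbracket ?c g bs k = C_const (sum_list bs) g n * Chat g bs"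
    if h: "length bs = n \<and> int (sum_list bs) \<ge> 2 * int g - 3 \<and> sum_list bs + 2 * k = 4*g+n-3" for bs k
  proof -
    \<comment> \<open>The sign exponent in the statement equals \<open>k\<close>, so it cancels the
      sign in \<open>dbracket\<close>.\<close>
    have "sum_list bs + 2 * k = 4 * g - 3 + length bs" "(4*g-3+n - sum_list bs) div 2 = k"
      using h assms by auto
    moreover have "hurwitz_coeff g n bs = C_const (sum_list bs) g n * Chat g bs"
      using h assms by (intro hurwitz_coeff_eq_C) auto
    ultimately show ?thesis by (simp add: dbracket_def flip: mult.assoc power_add)
  qed
  show "dbracket ?c g bs k = 0" if h: "length bs = n \<and> even (sum_list bs + n)" for bs k
  proof -
    \<comment> \<open>The degree condition would force \<open>sum_list bs + n\<close> to be odd, so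
      the bracket takes its default value 0.\<close>
    have "sum_list bs + 2 * k \<noteq> 4 * g - 3 + length bs"
    proof
      assume "sum_list bs + 2 * k = 4 * g - 3 + length bs"
      then have "(sum_list bs + n) + 2 * k + 3 = 4 * g + 2 * n" using h assms by simp
      then show False using h by presburger
    qed
    then show ?thesis by (simp add: dbracket_def)
  qed
  show "dbracket ?c g bs g = (-1) ^ g * multinomial_coeff bs *
          (1 - 2 ^ (2*g-1)) / (2 ^ (2*g-1) * fact (2*g)) * bernoulli_num (2*g)"
    if h: "length bs = n \<and> sum_list bs = 2*g+n-3" for bs
  proof -
    have "sum_list bs + 2 * g = 4 * g - 3 + length bs" using h assms by auto
    then have "dbracket ?c g bs g = (-1) ^ g * ?c bs" by (simp add: dbracket_def)
    then show ?thesis using hurwitz_coeff_lowest[OF assms(1), of bs n] h by simp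
  qed
qed

end
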